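(* For $m\in\frac12\mathbb N$ the following formula holds: $$\begin{aligned} &\theta_{0,m+1}\Big(\tau,\tfrac{(z_1-z_2)+m(z_1+z_3)}{m+1}\Big)\,\Phi^{[m,0]}(\tau,z_1,-z_3,0)\\ &-\theta_{0,m+1}\Big(\tau,\tfrac{(z_1-z_2)+m(z_1-2z_2-z_3)}{m+1}\Big)\,\Phi^{[m,0]}(\tau,z_2,z_1-z_2-z_3,0)\\ &+\sum_{j>0}\sum_{k=1}^{2mj}q^{(m+1)j^2}q^{-\frac{k^2}{4m}}P^{[m]}_{j,k}(z_1,z_2,z_3)\big[\theta_{k,m}-\theta_{-k,m}\big](\tau,z_1-z_3)\\ &=i\,\theta_{0,m+1}\Big(\tau,\tfrac{(z_1+z_2)+m(z_1-z_3)}{m+1}\Big)\frac{\eta(\tau)^3\,\vartheta_{11}(\tau,z_1-z_2)}{\vartheta_{11}(\tau,z_1)\,\vartheta_{11}(\tau,z_2)}\\ &\quad+i\,\theta_{0,m+1}\Big(\tau,\tfrac{(z_1-z_2-2z_3)+m(z_1-z_3)}{m+1}\Big)\frac{\eta(\tau)^3\,\vartheta_{11}(\tau,z_1-z_2)}{\vartheta_{11}(\tau,z_3)\,\vartheta_{11}(\tau,z_1-z_2-z_3)}, \end{aligned}$$ where $$\begin{aligned} P^{[m]}_{j,k}(z_1,z_2,z_3)={}&e^{2\pi ij(z_1-z_2)}e^{\pi i(2mj-k)(z_1-2z_2-z_3)}+e^{-2\pi ij(z_1-z_2)}e^{-\pi i(2mj-k)(z_1-2z_2-z_3)}\\ &-e^{2\pi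 ij(z_1-z_2)}e^{\pi i(2mj-k)(z_1+z_3)}-e^{-2\pi ij(z_1-z_2)}e^{-\pi i(2mj-k)(z_1+z_3)}. \end{aligned}$$
   Context: $\mathbb N$ is the set of positive integers; $\tau$ lies in the upper half-plane, $z_1,z_2,z_3,t\in\mathbb C$, $q=e^{2\pi i\tau}$, $q^a:=e^{2\pi ia\tau}$. For $m\in\frac12\mathbb N$, $s\in\frac12\mathbb Z$: $$\Phi^{[m,s]}_1(\tau,z_1,z_2,t)=e^{-2\pi imt}\sum_{j\in\mathbb Z}\frac{e^{2\pi imj(z_1+z_2)+2\pi isz_1}q^{mj^2+sj}}{1-e^{2\pi iz_1}q^j},\qquad \Phi^{[m,s]}_2(\tau,z_1,z_2,t)=e^{-2\pi imt}\sum_{j\in\mathbb Z}\frac{e^{-2\pi imj(z_1+z_2)-2\pi isz_2}q^{mj^2+sj}}{1-e^{-2\pi iz_2}q^j},$$ $\Phi^{[m,s]}=\Phi^{[m,s]}_1-\Phi^{[m,s]}_2$. $\theta_{k,m}(\tau,z)=\sum_{j\in\mathbb Z}e^{2\pi im(j+\frac{k}{2m})z}q^{m(j+\frac{k}{2m})^2}$; $[\theta_{k,m}-\theta_{-k,m}](\tau,z)=\theta_{k,m}(\tau,z)-\theta_{-k,m}(\tau,z)$. $\eta$ is the Dedekind eta function and $\vartheta_{ab}(\tau,z)=\sum_{n\in\mathbb Z}e^{\pi i(n+\frac a2)^2\tau+2\pi i(n+\frac a2)(z+\frac b2)}$ ($a,b\in\{0,1\}$) are Mumford's theta functions. The sum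 over $j>0$ is over positive integers $j$. Identities are identities of meromorphic functions of the variables. *)

theory Defs
  imports "HOL-Analysis.Analysis"
begin

text \<open>Everywhere \<open>\<tau>\<close> is meant to lie in the upper half-plane.  Powers of
  \<open>q = exp (2 \<pi> i \<tau>)\<close> are single-valued functions of \<open>\<tau>\<close>, not principal-branch powers of \<open>q\<close>.\<close>

definition qpow :: "complex \<Rightarrow> real \<Rightarrow> complex" where
  "qpow \<tau> a = exp (2 * of_real pi * \<i> * of_real a * \<tau>)"

definition Phi1 :: "real \<Rightarrow> real \<Rightarrow> complex \<Rightarrow> complex \<Rightarrow> complex \<Rightarrow> complex \<Rightarrow> complex" where
  "Phi1 m s \<tau> z1 z2 t =
     exp (- 2 * of_real pi * \<i> * of_real m * t) *
     (\<Sum>\<^sub>\<infinity>j\<in>(UNIV :: int set).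
        exp (2 * of_real pi * \<i> * of_real m * of_int j * (z1 + z2)
             + 2 * of_real pi * \<i> * of_real s * z1)
        * qpow \<tau> (m * of_int j ^ 2 + s * of_int j)
        / (1 - exp (2 * of_real pi * \<i> * z1) * qpow \<tau> (of_int j)))"

definition Phi2 :: "real \<Rightarrow> real \<Rightarrow> complex \<Rightarrow> complex \<Rightarrow> complex \<Rightarrow> complex \<Rightarrow> complex" where
  "Phi2 m s \<tau> z1 z2 t =
     exp (- 2 * of_real pi * \<i> * of_real m * t) *
     (\<Sum>\<^sub>\<infinity>j\<in>(UNIV :: int set).
        exp (- 2 * of_real pi * \<i> * of_real m * of_int j * (z1 + z2)
             - 2 * of_real pi * \<i> * of_real s * z2)
        * qpow \<tau> (m * of_int j ^ 2 + s * of_int j)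
        / (1 - exp (- 2 * of_real pi * \<i> * z2) * qpow \<tau> (of_int j)))"

definition Phi :: "real \<Rightarrow> real \<Rightarrow> complex \<Rightarrow> complex \<Rightarrow> complex \<Rightarrow> complex \<Rightarrow> complex" where
  "Phi m s \<tau> z1 z2 t = Phi1 m s \<tau> z1 z2 t - Phi2 m s \<tau> z1 z2 t"

definition theta :: "real \<Rightarrow> real \<Rightarrow> complex \<Rightarrow> complex \<Rightarrow> complex" where
  "theta k m \<tau> z =
     (\<Sum>\<^sub>\<infinity>j\<in>(UNIV :: int set).
        exp (2 * of_real pi * \<i> * of_real m * of_real (of_int j + k / (2 * m)) * z)
        * qpow \<tau> (m * (of_int j + k / (2 * m)) ^ 2))"

definition vartheta :: "nat \<Rightarrow> nat \<Rightarrow> complex \<Rightarrow> complex \<Rightarrow> complex" where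
  "vartheta a b \<tau> z =
     (\<Sum>\<^sub>\<infinity>n\<in>(UNIV :: int set).
        exp (of_real pi * \<i> * (of_int n + of_nat a / 2) ^ 2 * \<tau>
             + 2 * of_real pi * \<i> * (of_int n + of_nat a / 2) * (z + of_nat b / 2)))"

definition dedekind_eta :: "complex \<Rightarrow> complex" where
  "dedekind_eta \<tau> = qpow \<tau> (1 / 24) * (\<Prod>n. 1 - qpow \<tau> (real (Suc n)))"

definition P_term ::
  "real \<Rightarrow> nat \<Rightarrow> nat \<Rightarrow> complex \<Rightarrow> complex \<Rightarrow> complex \<Rightarrow> complex" where
  "P_term m j k z1 z2 z3 =
     exp (2 * of_real pi * \<i> * of_nat j * (z1 - z2))
       * exp (of_real pi * \<i> * of_real (2 * m * real j - real k) * (z1 - 2 * z2 - z3))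
   + exp (- 2 * of_real pi * \<i> * of_nat j * (z1 - z2))
       * exp (- of_real pi * \<i> * of_real (2 * m * real j - real k) * (z1 - 2 * z2 - z3))
   - exp (2 * of_real pi * \<i> * of_nat j * (z1 - z2))
       * exp (of_real pi * \<i> * of_real (2 * m * real j - real k) * (z1 + z3))
   - exp (- 2 * of_real pi * \<i> * of_nat j * (z1 - z2))
       * exp (- of_real pi * \<i> * of_real (2 * m * real j - real k) * (z1 + z3))"

text \<open>The zeros of \<open>vartheta 1 1 \<tau>\<close>, and the poles of \<open>Phi1\<close> in \<open>z1\<close> and of \<open>Phi2\<close> in \<open>z2\<close>,
  all lie in the period lattice.\<close>

definition period_lattice :: "complex \<Rightarrow> complex set" where
  "period_lattice \<tau> = {of_int a + of_int b * \<tau> | a b. True}"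

end

theory Submission
  imports Defs "HOL-Complex_Analysis.Complex_Analysis"
begin

text \<open>Put \<open>M = 2m\<close>, \<open>s = z1 - z3\<close>, \<open>x = z1 + z3\<close> and \<open>y = 2 z2 - z1 + z3\<close>.  The four numbers that may not lie in the
period lattice are, up to sign,
\<open>z1 = (s+x)/2\<close>, \<open>z2 = (s+y)/2\<close>, \<open>z3 = (x-s)/2\<close> and \<open>-(z1-z2-z3) = (y-s)/2\<close>.
In these variables the terms singular at \<open>z3\<close> and \<open>z1-z2-z3\<close> arise from those singular at \<open>z1\<close> and
\<open>z2\<close> by \<open>s \<mapsto> -s\<close> and a change of sign, so one identity for half of the terms suffices.

Suppose first that all four numbers have imaginary part in \<open>(0, Im \<tau>)\<close>.  There every denominator
\<open>1 - u q\<^sup>j\<close> expands into a geometric series, and every product in the half identity becomes an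
absolutely convergent triple series in the same monomials, indexed by the exponents \<open>A\<close> of \<open>x\<close>
and \<open>B\<close> of \<open>y\<close> and by an integer \<open>n\<close> with \<open>A + B + Mn\<close> the exponent of \<open>s\<close>:

  \<^item> the two products of a theta function and \<open>\<Phi>\<^sub>1\<close> (lemma \<open>theta_Phi1_expansion\<close>), and
  \<^item> the product with \<open>\<eta>\<^sup>3 \<vartheta>(a-c) / (\<vartheta>(a) \<vartheta>(c))\<close>, where \<open>a = z1\<close> and \<open>c = z2\<close>; this quotient is
    Kronecker's double series
    (lemmas \<open>kronecker_theta_quotient\<close> and \<open>theta_kronecker_expansion\<close>).

The coefficients are the signs of geometric expansions.  In the combination that occurs, their
dependence on \<open>n\<close> cancels (lemma \<open>sgn_cancellation\<close>).  Summation over \<open>n\<close> then produces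
\<open>\<theta>\<^bsub>A+B,m\<^esub>(\<tau>, s)\<close> with a coefficient supported in a double sector of the \<open>(A,B)\<close>-plane
(lemma \<open>strip_half_identity\<close>).  Subtracting the identity for \<open>-s\<close> replaces this theta function
by \<open>\<theta>\<^bsub>A+B,m\<^esub> - \<theta>\<^bsub>-(A+B),m\<^esub>\<close>, and the double sector falls into four pieces, each of them
parametrised by \<open>1 \<le> k < Mj\<close>; the four pieces give the four exponential terms of \<open>P\<^sub>j\<^sub>,\<^sub>k\<close>
(lemma \<open>half_plane_sum_eq_correction\<close>).

Kronecker's formula is reduced to the Appell series
\<open>\<Sum>\<^sub>k (-1)\<^sup>k q\<^bsup>k(k-1)/2\<^esup> / (1 - v q\<^sup>k)\<close>: the product of the Kronecker series with \<open>\<vartheta>(a)\<close> is a multiple of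
\<open>\<vartheta>(a+b)\<close> (lemma \<open>theta_times_kronecker\<close>), and the Appell series is a multiple of
\<open>\<eta>\<^sup>3/\<vartheta>(b)\<close> (lemma \<open>theta_times_appell\<close>), the constant being Jacobi's series for the cube of
the Euler product (lemma \<open>jacobi_cube\<close>).  The evaluation of the Appell series also shows that \<open>\<vartheta>\<close> has no zeros
outside the lattice.

Finally, both sides of the theorem are holomorphic along the complex line from the given point to
\<open>z1 = z2 = z3 = \<tau>/2\<close>, apart from countably many parameters.  Near the second point all four
imaginary parts lie in \<open>(0, Im \<tau>)\<close>, so the identity propagates to the given point.\<close>

section \<open>Exponential series\<close>

text \<open>Half-integral powers of \<open>q\<close> occur throughout, and \<open>ee \<tau>\<close> is \<open>q\<^bsup>1/2\<^esup>\<close>.  Every term of every series is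
written as a single value of \<open>ee\<close>, so that reindexing a series only requires an identity between
exponents; signs \<open>(-1)\<^sup>n\<close> are values \<open>ee n\<close>.\<close>

definition ee :: "complex \<Rightarrow> complex" where
  "ee z = exp (of_real pi * \<i> * z)"

lemma ee_add: "ee (x + y) = ee x * ee y"
  by (simp add: ee_def ring_distribs exp_add)

lemma ee_minus: "ee (- x) = inverse (ee x)"
  by (simp add: ee_def exp_minus)

lemma ee_diff: "ee (x - y) = ee x / ee y"
  by (simp add: ee_def ring_distribs exp_diff)

lemma ee_0 [simp]: "ee 0 = 1"
  by (simp add: ee_def)

lemma ee_nonzero [simp]: "ee x \<noteq> 0"
  by (simp add: ee_def)

lemma norm_ee: "norm (ee z) = exp (- pi * Im z)"
  by (simp add: ee_def)

lemma ee_two_of_int [simp]: "ee (2 * of_int n) = 1"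
  using exp_integer_2pi[of "of_int n"] by (simp add: ee_def mult_ac)

lemma ee_1 [simp]: "ee 1 = -1"
  by (simp add: ee_def)

lemma ee_of_int: "ee (of_int n) = (if even n then 1 else -1)"
proof (cases "even n")
  case True
  then obtain k where "n = 2 * k" by blast
  then show ?thesis using ee_two_of_int[of k] by simp
next
  case False
  then obtain k where "n = 2 * k + 1" using oddE by blast
  then show ?thesis using ee_two_of_int[of k] by (simp add: ee_add)
qed

lemma qpow_ee: "qpow \<tau> a = ee (2 * of_real a * \<tau>)"
  by (simp add: qpow_def ee_def mult_ac)

lemma holomorphic_on_ee [holomorphic_intros]:
  "f holomorphic_on U \<Longrightarrow> (\<lambda>t. ee (f t)) holomorphic_on U"
  unfolding ee_def by (intro holomorphic_intros)

lemma continuous_on_ee [continuous_intros]: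
  "continuous_on U f \<Longrightarrow> continuous_on U (\<lambda>t. ee (f t))"
  unfolding ee_def by (intro continuous_intros)

lemma ee_eq_1_iff: "ee (2 * z) = 1 \<longleftrightarrow> (\<exists>n::int. z = of_int n)"
proof -
  have "ee (2 * z) = 1 \<longleftrightarrow> (\<exists>n::int. of_real pi * \<i> * (2 * z) = of_int (2 * n) * pi * \<i>)"
    unfolding ee_def exp_eq_1 by (auto simp: complex_eq_iff)
  also have "\<dots> \<longleftrightarrow> (\<exists>n::int. z = of_int n)"
    by (rule arg_cong[where f = Ex]) (auto simp: fun_eq_iff)
  finally show ?thesis .
qed

lemma summable_exp_neg_abs_int:
  fixes \<epsilon> :: real
  assumes "\<epsilon> > 0"
  shows "(\<lambda>n::int. exp (- (\<epsilon> * \<bar>of_int n\<bar>))) summable_on UNIV"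
proof -
  have nat: "(\<lambda>n::nat. exp (- (\<epsilon> * real n))) summable_on UNIV"
  proof (rule norm_summable_imp_summable_on)
    have "(\<lambda>n. exp (-\<epsilon>) ^ n) = (\<lambda>n::nat. norm (exp (- (\<epsilon> * real n))))"
      by (simp add: fun_eq_iff exp_of_nat_mult [symmetric] mult_ac)
    moreover have "summable (\<lambda>n. exp (-\<epsilon>) ^ n)"
      by (rule summable_geometric) (use assms in simp)
    ultimately show "summable (\<lambda>n::nat. norm (exp (- (\<epsilon> * real n))))" by simp
  qed
  have "(\<lambda>n::int. exp (- (\<epsilon> * \<bar>of_int n\<bar>))) summable_on range int"
    by (subst summable_on_reindex) (use nat in \<open>auto simp: o_def inj_on_def\<close>)
  moreover have "(\<lambda>n::int. exp (- (\<epsilon> * \<bar>of_int n\<bar>))) summable_on range (\<lambda>n. - int n)"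
    by (subst summable_on_reindex) (use nat in \<open>auto simp: o_def inj_on_def\<close>)
  ultimately have "(\<lambda>n::int. exp (- (\<epsilon> * \<bar>of_int n\<bar>))) summable_on range int \<union> range (\<lambda>n. - int n)"
    by (rule summable_on_union)
  also have "range int \<union> range (\<lambda>n. - int n) = UNIV"
    by (metis (no_types, lifting) UNIV_eq_I Un_iff int_cases2 rangeI)
  finally show ?thesis .
qed

lemma gaussian_summable:
  fixes a b :: real
  assumes "a > 0"
  shows "(\<lambda>n::int. exp (- a * of_int n ^ 2 + b * \<bar>of_int n\<bar>)) summable_on UNIV"
proof (rule summable_on_comparison_test)
  \<comment> \<open>the maximum of \<open>- a x\<^sup>2 + (b + 1) x\<close>\<close>
  define C where "C = (b + 1) ^ 2 / (4 * a)"
  show "(\<lambda>n::int. exp C * exp (- \<bar>of_int n\<bar> :: real)) summable_on UNIV"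
    using summable_on_cmult_right[OF summable_exp_neg_abs_int[of 1]] by simp
  fix n :: int
  have *: "- a * x ^ 2 + b * x \<le> C - x" for x :: real
  proof -
    have "0 \<le> (2 * a * x - (b + 1)) ^ 2 / (4 * a)" using assms by simp
    also have "\<dots> = a * x ^ 2 - b * x - x + C"
      using assms by (simp add: C_def field_simps power2_eq_square)
    finally show ?thesis by simp
  qed
  from *[of "\<bar>of_int n\<bar>"]
  show "exp (- a * of_int n ^ 2 + b * \<bar>of_int n\<bar>) \<le> exp C * exp (- \<bar>of_int n\<bar> :: real)"
    by (simp flip: exp_add)
qed auto

text \<open>This bound is uniform in \<open>B\<close> and \<open>C\<close>, so it gives both absolute convergence and the locally
uniform convergence that makes the series holomorphic in \<open>B\<close> and \<open>C\<close>.\<close>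

lemma norm_ee_quadratic_le:
  assumes "\<bar>Im B\<bar> \<le> b" "\<bar>Im C\<bar> \<le> c"
  shows "norm (ee (A * of_int n ^ 2 + B * of_int n + C)) \<le>
           exp (pi * c) * exp (- (pi * Im A) * of_int n ^ 2 + (pi * b) * \<bar>of_int n\<bar>)"
proof -
  have "Im (A * of_int n ^ 2 + B * of_int n + C) = Im A * of_int n ^ 2 + Im B * of_int n + Im C"
    by (simp flip: of_int_power)
  moreover have "- Im B * of_int n \<le> b * \<bar>of_int n\<bar>"
    by (rule order_trans[OF abs_ge_self]) (use assms in \<open>auto simp: abs_mult intro: mult_right_mono\<close>)
  moreover have "- Im C \<le> c" using assms by linarith
  ultimately have "- Im (A * of_int n ^ 2 + B * of_int n + C) \<le> c + (- Im A * of_int n ^ 2 + b * \<bar>of_int n\<bar>)"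
    by simp
  then have "pi * (- Im (A * of_int n ^ 2 + B * of_int n + C)) \<le> pi * (c + (- Im A * of_int n ^ 2 + b * \<bar>of_int n\<bar>))"
    by (rule mult_left_mono) simp
  then show ?thesis unfolding norm_ee exp_add[symmetric] by (simp add: algebra_simps)
qed

lemma ee_quadratic_summable:
  assumes "Im A > 0"
  shows "(\<lambda>n::int. norm (ee (A * of_int n ^ 2 + B * of_int n + C))) summable_on UNIV"
proof (rule summable_on_comparison_test)
  show "(\<lambda>n::int. exp (pi * \<bar>Im C\<bar>) * exp (- (pi * Im A) * of_int n ^ 2 + (pi * \<bar>Im B\<bar>) * \<bar>of_int n\<bar>))
          summable_on UNIV"
    by (intro summable_on_cmult_right gaussian_summable) (use assms in simp)
qed (use norm_ee_quadratic_le in auto)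

lemma holomorphic_on_infsum:
  fixes f :: "'i \<Rightarrow> complex \<Rightarrow> complex"
  assumes U: "open U" and hol: "\<And>i. f i holomorphic_on U"
    and bound: "\<And>K. compact K \<Longrightarrow> K \<subseteq> U \<Longrightarrow> \<exists>M. M summable_on I \<and> (\<forall>i\<in>I. \<forall>w\<in>K. norm (f i w) \<le> M i)"
  shows "(\<lambda>z. \<Sum>\<^sub>\<infinity>i\<in>I. f i z) holomorphic_on U"
proof -
  have "\<exists>r>0. (\<lambda>z. \<Sum>\<^sub>\<infinity>i\<in>I. f i z) holomorphic_on ball z r" if z: "z \<in> U" for z
  proof -
    obtain r where r: "r > 0" "cball z r \<subseteq> U"
      using U z open_contains_cball by blast
    obtain M where M: "M summable_on I" "\<forall>i\<in>I. \<forall>w\<in>cball z r. norm (f i w) \<le> M i"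
      using bound[of "cball z r"] r by auto
    have lim: "uniform_limit (cball z r) (\<lambda>X y. \<Sum>x\<in>X. f x y) (\<lambda>y. \<Sum>\<^sub>\<infinity>x\<in>I. f x y) (finite_subsets_at_top I)"
      by (rule Weierstrass_m_test_general) (use M in auto)
    have hol': "(\<lambda>y. \<Sum>x\<in>X. f x y) holomorphic_on cball z r" for X
      by (rule holomorphic_on_subset[of _ U]) (use r hol in \<open>auto intro!: holomorphic_intros\<close>)
    have "eventually (\<lambda>X. continuous_on (cball z r) (\<lambda>y. \<Sum>x\<in>X. f x y) \<and>
              (\<lambda>y. \<Sum>x\<in>X. f x y) holomorphic_on ball z r) (finite_subsets_at_top I)"
      by (rule always_eventually) (use hol' in \<open>auto intro: holomorphic_on_imp_continuous_on holomorphic_on_subset[OF _ ball_subset_cball]\<close>)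
    from holomorphic_uniform_limit[OF this lim] r(1) show ?thesis
      by auto
  qed
  then show ?thesis
    by (metis analytic_on_def analytic_imp_holomorphic)
qed

lemma holomorphic_Im_bounded_on_compact:
  assumes "g holomorphic_on U" "compact K" "K \<subseteq> U"
  shows "\<exists>b. \<forall>w\<in>K. \<bar>Im (g w)\<bar> \<le> b"
proof -
  have "compact (g ` K)"
    using assms by (meson compact_continuous_image holomorphic_on_imp_continuous_on holomorphic_on_subset)
  then obtain b where "\<forall>w\<in>K. norm (g w) \<le> b"
    using compact_imp_bounded bounded_iff by (metis imageI)
  then show ?thesis by (meson abs_Im_le_cmod order_trans)
qed

lemma holomorphic_gauss_series:
  assumes "open U" "B holomorphic_on U" "C holomorphic_on U" "Im A > 0"
  shows "(\<lambda>t. \<Sum>\<^sub>\<infinity>n\<in>(UNIV::int set). ee (A * of_int n ^ 2 + B t * of_int n + C t)) holomorphic_on U"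
proof (rule holomorphic_on_infsum)
  fix K assume K: "compact K" "K \<subseteq> U"
  note bdd = holomorphic_Im_bounded_on_compact[OF _ K]
  obtain b c where bc: "\<forall>w\<in>K. \<bar>Im (B w)\<bar> \<le> b" "\<forall>w\<in>K. \<bar>Im (C w)\<bar> \<le> c"
    using bdd assms by meson
  show "\<exists>M. M summable_on UNIV \<and> (\<forall>n::int\<in>UNIV. \<forall>w\<in>K. norm (ee (A * of_int n ^ 2 + B w * of_int n + C w)) \<le> M n)"
  proof (intro exI conjI ballI)
    show "(\<lambda>n::int. exp (pi * c) * exp (- (pi * Im A) * of_int n ^ 2 + (pi * b) * \<bar>of_int n\<bar>)) summable_on UNIV"
      by (intro summable_on_cmult_right gaussian_summable) (use assms in simp)
  qed (use bc in \<open>intro norm_ee_quadratic_le; blast\<close>)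
qed (use assms in \<open>auto intro!: holomorphic_intros\<close>)

section \<open>Series with denominators and the period lattice\<close>

lemma period_lattice_uminus: "- z \<in> period_lattice \<tau> \<longleftrightarrow> z \<in> period_lattice \<tau>"
proof -
  have *: "- z \<in> period_lattice \<tau>" if z: "z \<in> period_lattice \<tau>" for z
  proof -
    obtain a b where "z = of_int a + of_int b * \<tau>" using z by (auto simp: period_lattice_def)
    then have "- z = of_int (- a) + of_int (- b) * \<tau>" by simp
    then show ?thesis unfolding period_lattice_def by blast
  qed
  show ?thesis using *[of z] *[of "-z"] by auto
qed

lemma closed_period_lattice:
  assumes "Im \<tau> > 0"
  shows "closed (period_lattice \<tau>)"
proof -
  define \<beta> where "\<beta> z = Im z / Im \<tau>" for z
  define \<alpha> where "\<alpha> z = Re z - \<beta> z * Re \<tau>" for z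
  have "period_lattice \<tau> = \<alpha> -` \<int> \<inter> \<beta> -` \<int>"
  proof (intro set_eqI iffI)
    fix z assume "z \<in> period_lattice \<tau>"
    then obtain a b where z: "z = of_int a + of_int b * \<tau>" by (auto simp: period_lattice_def)
    have b: "\<beta> z = of_int b" using assms by (simp add: \<beta>_def z)
    moreover have "\<alpha> z = of_int a" by (simp add: \<alpha>_def b) (simp add: z)
    ultimately show "z \<in> \<alpha> -` \<int> \<inter> \<beta> -` \<int>" by auto
  next
    fix z assume "z \<in> \<alpha> -` \<int> \<inter> \<beta> -` \<int>"
    then obtain a b where ab: "\<alpha> z = of_int a" "\<beta> z = of_int b" by (auto elim!: Ints_cases)
    have "Im z = of_int b * Im \<tau>" using ab(2) assms by (simp add: \<beta>_def field_simps)
    moreover have "Re z = of_int a + of_int b * Re \<tau>" using ab by (simp add: \<alpha>_def)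
    ultimately have "z = of_int a + of_int b * \<tau>" by (simp add: complex_eq_iff)
    then show "z \<in> period_lattice \<tau>" by (auto simp: period_lattice_def)
  qed
  moreover have "continuous_on UNIV \<alpha>" "continuous_on UNIV \<beta>"
    unfolding \<alpha>_def[abs_def] \<beta>_def[abs_def] using assms by (auto intro!: continuous_intros)
  ultimately show ?thesis
    by (auto intro!: closed_Int closed_vimage)
qed

lemma countable_period_lattice: "countable (period_lattice \<tau>)"
proof -
  have "period_lattice \<tau> = (\<lambda>(a, b). of_int a + of_int b * \<tau>) ` (UNIV :: (int \<times> int) set)"
    by (auto simp: period_lattice_def)
  then show ?thesis by simp
qed

lemma strip_not_in_lattice:
  assumes "0 < Im z" "Im z < Im \<tau>"
  shows "z \<notin> period_lattice \<tau>"
proof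
  assume "z \<in> period_lattice \<tau>"
  then obtain a b where "z = of_int a + of_int b * \<tau>" by (auto simp: period_lattice_def)
  then have "0 < of_int b * Im \<tau>" "of_int b * Im \<tau> < 1 * Im \<tau>" using assms by auto
  moreover have "Im \<tau> > 0" using assms by simp
  ultimately have "0 < b" "b < 1"
    by (auto simp: zero_less_mult_iff mult_less_cancel_right)
  then show False by simp
qed

lemma not_in_lattice_denom:
  assumes "z \<notin> period_lattice \<tau>"
  shows "1 - ee (2 * (z + of_int j * \<tau>)) \<noteq> 0"
proof
  assume "1 - ee (2 * (z + of_int j * \<tau>)) = 0"
  then obtain n :: int where "z + of_int j * \<tau> = of_int n"
    using ee_eq_1_iff[of "z + of_int j * \<tau>"] by (auto simp: algebra_simps)
  then have "z = of_int n + of_int (- j) * \<tau>" by (simp add: eq_diff_eq)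
  then show False using assms unfolding period_lattice_def by blast
qed

text \<open>For all but finitely many \<open>j\<close> the number \<open>u q\<^sup>j\<close> has modulus at most \<open>1/2\<close> or at least \<open>2\<close>, uniformly
on the compact set; for each of the remaining \<open>j\<close> a continuous function without zeros is bounded
away from \<open>0\<close>.\<close>

lemma denom_lower_bound:
  fixes f :: "complex \<Rightarrow> complex"
  assumes \<tau>: "Im \<tau> > 0" and K: "compact K" and cont: "continuous_on K f"
    and L: "\<And>t. t \<in> K \<Longrightarrow> f t \<notin> period_lattice \<tau>"
  obtains \<delta> where "\<delta> > 0" "\<And>t j. t \<in> K \<Longrightarrow> \<delta> \<le> norm (1 - ee (2 * (f t + of_int j * \<tau>)))"
proof (cases "K = {}")
  case True
  then show ?thesis using that[of 1] by auto
next
  case False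
  have "compact (f ` K)" using K cont by (rule compact_continuous_image[rotated])
  then obtain B where B0: "\<forall>w\<in>K. norm (f w) \<le> B"
    using compact_imp_bounded bounded_iff by (metis imageI)
  then have B: "\<bar>Im (f w)\<bar> \<le> B" if "w \<in> K" for w
    using that by (meson abs_Im_le_cmod order_trans)
  obtain J :: nat where J: "B + 1 < of_nat J * Im \<tau>"
    using reals_Archimedean3[OF \<tau>] by blast
  have "\<exists>d>0. \<forall>t\<in>K. d \<le> norm (1 - ee (2 * (f t + of_int j * \<tau>)))" for j
  proof -
    have "continuous_on K (\<lambda>t. norm (1 - ee (2 * (f t + of_int j * \<tau>))))"
      by (intro continuous_intros cont)
    then obtain t0 where "t0 \<in> K" "\<forall>t\<in>K. norm (1 - ee (2 * (f t0 + of_int j * \<tau>))) \<le> norm (1 - ee (2 * (f t + of_int j * \<tau>)))"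
      using continuous_attains_inf[OF K False] by blast
    moreover from this have "norm (1 - ee (2 * (f t0 + of_int j * \<tau>))) > 0"
      using not_in_lattice_denom[OF L] by simp
    ultimately show ?thesis by blast
  qed
  then obtain d where d: "\<And>j. d j > 0" "\<And>j t. t \<in> K \<Longrightarrow> d j \<le> norm (1 - ee (2 * (f t + of_int j * \<tau>)))"
    by metis
  define \<delta> where "\<delta> = Min (insert (1/2) (d ` {- int J..int J}))"
  have \<delta>: "\<delta> > 0" "\<delta> \<le> 1/2"
    using d(1) by (auto simp: \<delta>_def)
  have \<delta>': "\<delta> \<le> d j" if "j \<in> {- int J..int J}" for j
    unfolding \<delta>_def by (rule Min_le) (use that in auto)
  have "\<delta> \<le> norm (1 - ee (2 * (f t + of_int j * \<tau>)))" if t: "t \<in> K" for t j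
  proof -
    define X where "X = norm (ee (2 * (f t + of_int j * \<tau>)))"
    have X: "X = exp (- (2 * pi * (Im (f t) + of_int j * Im \<tau>)))"
      by (simp add: X_def norm_ee mult_ac)
    have half: "exp (- (2 * pi)) \<le> (1/2 :: real)"
    proof -
      have "(2::real) \<le> exp 1" using exp_ge_add_one_self[of 1] by simp
      also have "\<dots> \<le> exp (2 * pi)" using pi_gt3 by simp
      finally show ?thesis by (simp add: exp_minus field_simps)
    qed
    consider "j > int J" | "j < - int J" | "j \<in> {- int J..int J}" by force
    then show ?thesis
    proof cases
      case 1
      then have "of_nat J * Im \<tau> \<le> of_int j * Im \<tau>" using \<tau> by (intro mult_right_mono) auto
      then have "1 \<le> Im (f t) + of_int j * Im \<tau>" using J B[OF t] by linarith
      then have "2 * pi \<le> 2 * pi * (Im (f t) + of_int j * Im \<tau>)" by simp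
      then have "X \<le> exp (- (2 * pi))" unfolding X by simp
      then have "1/2 \<le> 1 - X" using half by linarith
      also have "\<dots> \<le> norm (1 - ee (2 * (f t + of_int j * \<tau>)))"
        using norm_triangle_ineq2[of 1 "ee (2 * (f t + of_int j * \<tau>))"] by (simp add: X_def)
      finally show ?thesis using \<delta>(2) by linarith
    next
      case 2
      then have "of_int j * Im \<tau> \<le> of_int (- int J) * Im \<tau>" using \<tau> by (intro mult_right_mono) (auto simp del: of_int_minus)
      then have "1 \<le> - (Im (f t) + of_int j * Im \<tau>)" using J B[OF t] by simp
      from mult_left_mono[OF this, of "2 * pi"]
      have "2 * pi \<le> - (2 * pi * (Im (f t) + of_int j * Im \<tau>))" by (simp only: mult_1_right mult_minus_right) simp
      then have "exp (2 * pi) \<le> X" unfolding X by (simp only: exp_le_cancel_iff)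
      moreover have "exp (2 * pi) \<ge> (2::real)" using half by (simp add: exp_minus field_simps)
      ultimately have "1/2 \<le> X - 1" by linarith
      also have "\<dots> \<le> norm (1 - ee (2 * (f t + of_int j * \<tau>)))"
        using norm_triangle_ineq2[of "ee (2 * (f t + of_int j * \<tau>))" 1] by (simp add: X_def norm_minus_commute)
      finally show ?thesis using \<delta>(2) by linarith
    next
      case 3
      then show ?thesis using \<delta>'[of j] d(2)[OF t, of j] by linarith
    qed
  qed
  then show ?thesis using that \<delta>(1) by blast
qed

lemma lerch_summable:
  assumes \<tau>: "Im \<tau> > 0" and A: "Im A > 0" and z: "z \<notin> period_lattice \<tau>"
  shows "(\<lambda>n::int. norm (ee (A * of_int n ^ 2 + B * of_int n + C) / (1 - ee (2 * (z + of_int n * \<tau>))))) summable_on UNIV"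
proof -
  obtain \<delta> where \<delta>: "\<delta> > 0" "\<And>t j. t \<in> {z} \<Longrightarrow> \<delta> \<le> norm (1 - ee (2 * (t + of_int j * \<tau>)))"
    using denom_lower_bound[OF \<tau>, of "{z}" "\<lambda>t. t"] z by auto
  show ?thesis
  proof (rule summable_on_comparison_test)
    show "(\<lambda>n::int. inverse \<delta> * norm (ee (A * of_int n ^ 2 + B * of_int n + C))) summable_on UNIV"
      by (intro summable_on_cmult_right ee_quadratic_summable A)
    fix n :: int
    show "norm (ee (A * of_int n ^ 2 + B * of_int n + C) / (1 - ee (2 * (z + of_int n * \<tau>)))) \<le>
            inverse \<delta> * norm (ee (A * of_int n ^ 2 + B * of_int n + C))"
      unfolding norm_divide using \<delta> by (simp add: divide_simps mult.commute mult_left_mono)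
  qed auto
qed

lemma holomorphic_lerch_series:
  assumes U: "open U" and hol: "B holomorphic_on U" "C holomorphic_on U" "f holomorphic_on U" and A: "Im A > 0"
    and \<tau>: "Im \<tau> > 0" and L: "\<And>t. t \<in> U \<Longrightarrow> f t \<notin> period_lattice \<tau>"
  shows "(\<lambda>t. \<Sum>\<^sub>\<infinity>n\<in>(UNIV::int set). ee (A * of_int n ^ 2 + B t * of_int n + C t)
            / (1 - ee (2 * (f t + of_int n * \<tau>)))) holomorphic_on U"
proof (rule holomorphic_on_infsum)
  fix K assume K: "compact K" "K \<subseteq> U"
  note bdd = holomorphic_Im_bounded_on_compact[OF _ K]
  obtain b c where bc: "\<forall>w\<in>K. \<bar>Im (B w)\<bar> \<le> b" "\<forall>w\<in>K. \<bar>Im (C w)\<bar> \<le> c"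
    using bdd hol by meson
  have "continuous_on K f"
    using K hol by (meson holomorphic_on_imp_continuous_on holomorphic_on_subset)
  then obtain \<delta> where \<delta>: "\<delta> > 0" "\<And>t j. t \<in> K \<Longrightarrow> \<delta> \<le> norm (1 - ee (2 * (f t + of_int j * \<tau>)))"
    using denom_lower_bound[OF \<tau> K(1)] L K(2) by blast
  define M where "M = (\<lambda>n::int. inverse \<delta> * (exp (pi * c) * exp (- (pi * Im A) * of_int n ^ 2 + (pi * b) * \<bar>of_int n\<bar>)))"
  have "norm (ee (A * of_int n ^ 2 + B w * of_int n + C w) / (1 - ee (2 * (f w + of_int n * \<tau>)))) \<le> M n"
    if w: "w \<in> K" for w n
  proof -
    have "norm (ee (A * of_int n ^ 2 + B w * of_int n + C w) / (1 - ee (2 * (f w + of_int n * \<tau>)))) \<le>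
          inverse \<delta> * norm (ee (A * of_int n ^ 2 + B w * of_int n + C w))"
      unfolding norm_divide using \<delta>(1) \<delta>(2)[OF w, of n] by (simp add: divide_simps mult.commute mult_left_mono)
    also have "\<dots> \<le> M n"
      unfolding M_def using bc w \<delta>(1) by (intro mult_left_mono norm_ee_quadratic_le) auto
    finally show ?thesis .
  qed
  moreover have "M summable_on UNIV"
    unfolding M_def by (intro summable_on_cmult_right gaussian_summable) (use A in simp)
  ultimately show "\<exists>M. M summable_on UNIV \<and> (\<forall>n::int\<in>UNIV. \<forall>w\<in>K.
      norm (ee (A * of_int n ^ 2 + B w * of_int n + C w) / (1 - ee (2 * (f w + of_int n * \<tau>)))) \<le> M n)"
    by blast
next
  fix n :: int
  show "(\<lambda>t. ee (A * of_int n ^ 2 + B t * of_int n + C t) / (1 - ee (2 * (f t + of_int n * \<tau>)))) holomorphic_on U"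
    by (intro holomorphic_intros hol) (use L not_in_lattice_denom in blast)
qed (rule U)

section \<open>Jacobi's series for the cube of the Euler product\<close>

definition qfac :: "complex \<Rightarrow> nat \<Rightarrow> complex" where
  "qfac q n = (\<Prod>i<n. 1 - q ^ Suc i)"

text \<open>The Gaussian binomial coefficient.\<close>

definition qbin :: "complex \<Rightarrow> nat \<Rightarrow> nat \<Rightarrow> complex" where
  "qbin q n k = (if k \<le> n then qfac q n / (qfac q k * qfac q (n - k)) else 0)"

lemma qfac_0 [simp]: "qfac q 0 = 1"
  by (simp add: qfac_def)

lemma qfac_Suc: "qfac q (Suc n) = qfac q n * (1 - q ^ Suc n)"
  by (simp add: qfac_def)

lemma power_neq_1:
  fixes q :: complex
  assumes "norm q < 1"
  shows "q ^ Suc n \<noteq> 1"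
proof
  assume "q ^ Suc n = 1"
  then have "norm q ^ Suc n = 1" by (metis norm_one norm_power)
  moreover have "norm q ^ Suc n < 1" using assms power_strict_mono[of "norm q" 1 "Suc n"] by simp
  ultimately show False by simp
qed

lemma qfac_nonzero: "norm q < 1 \<Longrightarrow> qfac q n \<noteq> 0"
  using power_neq_1[of q] by (auto simp: qfac_def simp del: power_Suc)

text \<open>The numerators satisfy \<open>1 - q\<^bsup>n+1\<^esup> = (1 - q\<^bsup>n-k\<^esup>) + q\<^bsup>n-k\<^esup> (1 - q\<^bsup>k+1\<^esup>)\<close>.\<close>

lemma qbin_Pascal:
  assumes q: "norm q < 1" and k: "k \<le> n"
  shows "qbin q (Suc n) (Suc k) = qbin q n (Suc k) + q ^ (n - k) * qbin q n k"
proof (cases "k = n")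
  case True
  then show ?thesis using qfac_nonzero[OF q] by (simp add: qbin_def)
next
  case False
  then obtain d where n: "n = Suc (k + d)" using k less_imp_Suc_add[of k n] by auto
  have nz: "qfac q i \<noteq> 0" for i by (rule qfac_nonzero[OF q])
  have nz': "1 - q ^ Suc i \<noteq> 0" for i using power_neq_1[OF q, of i] by simp
  have "qbin q (Suc n) (Suc k) = qfac q n * (1 - q ^ Suc n) / (qfac q (Suc k) * qfac q (Suc d))"
    using n by (simp add: qbin_def qfac_Suc)
  also have "1 - q ^ Suc n = (1 - q ^ Suc d) + q ^ Suc d * (1 - q ^ Suc k)"
    by (simp add: n algebra_simps power_add)
  also have "qfac q n * \<dots> / (qfac q (Suc k) * qfac q (Suc d)) =
      qfac q n * (1 - q ^ Suc d) / (qfac q (Suc k) * qfac q (Suc d)) +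
      q ^ Suc d * (qfac q n * (1 - q ^ Suc k) / (qfac q (Suc k) * qfac q (Suc d)))"
    by (simp only: distrib_left add_divide_distrib mult.left_commute times_divide_eq_right)
  also have "qfac q n * (1 - q ^ Suc d) / (qfac q (Suc k) * qfac q (Suc d)) = qfac q n / (qfac q (Suc k) * qfac q d)"
    unfolding qfac_Suc[of q d] using nz'[of d] nz by (simp add: divide_simps)
  also have "\<dots> = qbin q n (Suc k)"
    using n by (simp add: qbin_def)
  also have "qfac q n * (1 - q ^ Suc k) / (qfac q (Suc k) * qfac q (Suc d)) = qfac q n / (qfac q k * qfac q (Suc d))"
    unfolding qfac_Suc[of q k] using nz'[of k] nz by (simp add: divide_simps)
  also have "\<dots> = qbin q n k"
    using n by (simp add: qbin_def)
  finally show ?thesis using n by simp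
qed

lemma qbinomial:
  assumes q: "norm q < 1"
  shows "(\<Prod>i<n. 1 - x * q ^ i) = (\<Sum>k\<le>n. (-1) ^ k * q ^ (k choose 2) * qbin q n k * x ^ k)"
proof (induction n)
  case 0
  have z: "(0::nat) choose 2 = 0" by (rule binomial_eq_0) simp
  show ?case by (simp add: qbin_def) (simp only: z power_0)
next
  case (Suc n)
  have z: "(0::nat) choose 2 = 0" by (rule binomial_eq_0) simp
  define c where "c k = (-1) ^ k * q ^ (k choose 2) * qbin q n k * x ^ k" for k
  have "(\<Sum>k\<le>Suc n. (-1) ^ k * q ^ (k choose 2) * qbin q (Suc n) k * x ^ k) =
        qbin q (Suc n) 0 + (\<Sum>k\<le>n. (-1) ^ Suc k * q ^ (Suc k choose 2) * qbin q (Suc n) (Suc k) * x ^ Suc k)"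
    by (subst sum.atMost_Suc_shift) (simp only: z power_0 mult_1_left mult_1_right)
  also have "\<dots> = c 0 + (\<Sum>k\<le>n. c (Suc k) - x * q ^ n * c k)"
  proof (intro arg_cong2[where f = "(+)"] sum.cong refl)
    show "qbin q (Suc n) 0 = c 0" 
      unfolding c_def z power_0 using qfac_nonzero[OF q] by (simp add: qbin_def)
    fix k assume "k \<in> {..n}"
    then have k: "k \<le> n" by simp
    have "(Suc k choose 2) + (n - k) = (k choose 2) + n"
      using k by (simp add: numeral_2_eq_2)
    then have e: "q ^ (Suc k choose 2) * q ^ (n - k) = q ^ (k choose 2) * q ^ n"
      by (simp flip: power_add)
    have "q ^ (Suc k choose 2) * qbin q (Suc n) (Suc k) =
          q ^ (Suc k choose 2) * qbin q n (Suc k) + (q ^ (Suc k choose 2) * q ^ (n - k)) * qbin q n k"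
      unfolding qbin_Pascal[OF q k] by (simp add: ring_distribs)
    also note e
    finally have *: "q ^ (Suc k choose 2) * qbin q (Suc n) (Suc k) =
          q ^ (Suc k choose 2) * qbin q n (Suc k) + q ^ (k choose 2) * q ^ n * qbin q n k" .
    have "(-1) ^ Suc k * q ^ (Suc k choose 2) * qbin q (Suc n) (Suc k) * x ^ Suc k =
          (-1) ^ Suc k * x ^ Suc k * (q ^ (Suc k choose 2) * qbin q (Suc n) (Suc k))" by simp
    also note *
    finally show "(-1) ^ Suc k * q ^ (Suc k choose 2) * qbin q (Suc n) (Suc k) * x ^ Suc k = c (Suc k) - x * q ^ n * c k"
      by (simp add: c_def ring_distribs)
  qed
  also have "\<dots> = (c 0 + (\<Sum>k\<le>n. c (Suc k))) - x * q ^ n * (\<Sum>k\<le>n. c k)"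
    by (simp add: sum_subtractf sum_distrib_left)
  also have "c 0 + (\<Sum>k\<le>n. c (Suc k)) = (\<Sum>k\<le>Suc n. c k)"
    by (rule sum.atMost_Suc_shift [symmetric])
  also have "\<dots> = (\<Sum>k\<le>n. c k)"
    by (simp add: c_def qbin_def)
  also have "(\<Sum>k\<le>n. c k) = (\<Prod>i<n. 1 - x * q ^ i)"
    using Suc by (simp add: c_def)
  finally show ?case by (simp add: ring_distribs)
qed

lemma ee_of_nat_mult: "ee (of_nat n * x) = ee x ^ n"
  by (simp add: ee_def mult_ac exp_of_nat_mult [symmetric])

lemma of_nat_choose_two: "2 * (of_nat (k choose 2) :: complex) = of_nat k * (of_nat k - 1)"
  by (induction k) (simp_all add: numeral_2_eq_2 algebra_simps)

text \<open>At the zero \<open>x = q\<^bsup>-N\<^esup>\<close> of the product in the \<open>q\<close>-binomial theorem, completing the square at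
\<open>k = N + n\<close> turns the terms of the sum into \<open>(-1)\<^sup>n q\<^bsup>n(n-1)/2\<^esup>\<close>, up to a factor that depends on \<open>N\<close> only.\<close>

lemma finite_jacobi_term:
  fixes \<tau> :: complex
  defines "q \<equiv> ee (2 * \<tau>)"
  shows "(-1) ^ k * q ^ (k choose 2) * inverse (q ^ N) ^ k =
    (-1) ^ N * ee (- of_nat (N * Suc N) * \<tau>)
      * ee (of_int (int k - int N) + (of_int (int k - int N) ^ 2 - of_int (int k - int N)) * \<tau>)"
proof -
  have 1: "(-1) ^ k = (-1) ^ N * ee (of_int (int k - int N))"
    unfolding ee_of_int by (cases "even k"; cases "even N") auto
  have "q ^ (k choose 2) * inverse (q ^ N) ^ k = ee (of_nat (k choose 2) * (2 * \<tau>)) * ee (- (of_nat (N * k) * (2 * \<tau>)))"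
    unfolding q_def ee_minus ee_of_nat_mult by (simp add: power_mult power_inverse)
  also have "\<dots> = ee ((of_nat k * (of_nat k - 1)) * \<tau> - of_nat (N * k) * (2 * \<tau>))"
    by (simp flip: ee_add of_nat_choose_two) (simp add: algebra_simps)
  also have "(of_nat k * (of_nat k - 1)) * \<tau> - of_nat (N * k) * (2 * \<tau>) =
     - of_nat (N * Suc N) * \<tau> + (of_int (int k - int N) ^ 2 - of_int (int k - int N)) * \<tau>"
    by (simp add: algebra_simps power2_eq_square)
  finally show ?thesis by (simp add: 1 ee_add mult_ac)
qed

lemma prod_reflect_qfac:
  fixes \<tau> :: complex
  defines "q \<equiv> ee (2 * \<tau>)"
  shows "(\<Prod>i<N. 1 - inverse (q ^ N) * q ^ i) = (-1) ^ N * ee (- of_nat (N * Suc N) * \<tau>) * qfac q N"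
proof -
  have q0: "q \<noteq> 0" by (simp add: q_def)
  have "(\<Prod>i<N. 1 - inverse (q ^ N) * q ^ i) = (\<Prod>i<N. 1 - inverse (q ^ N) * q ^ (N - Suc i))"
    by (rule prod.nat_diff_reindex [symmetric])
  also have "\<dots> = (\<Prod>i<N. (- inverse (q ^ Suc i)) * (1 - q ^ Suc i))"
  proof (rule prod.cong)
    fix i assume "i \<in> {..<N}"
    then have "q ^ N = q ^ (N - Suc i) * q ^ Suc i" by (simp flip: power_add del: power_Suc)
    then show "1 - inverse (q ^ N) * q ^ (N - Suc i) = (- inverse (q ^ Suc i)) * (1 - q ^ Suc i)"
      using q0 by (simp add: field_simps)
  qed simp
  also have "\<dots> = (\<Prod>i<N. - inverse (q ^ Suc i)) * qfac q N"
    by (simp only: prod.distrib qfac_def)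
  also have "(\<Prod>i<N. - inverse (q ^ Suc i)) = (-1) ^ N * ee (- of_nat (N * Suc N) * \<tau>)"
  proof (induction N)
    case (Suc N)
    have "inverse (q ^ Suc N) = ee (- (of_nat (Suc N) * (2 * \<tau>)))"
      by (simp only: q_def ee_minus ee_of_nat_mult)
    then have "(\<Prod>i<Suc N. - inverse (q ^ Suc i)) =
        (-1) ^ Suc N * (ee (- of_nat (N * Suc N) * \<tau>) * ee (- (of_nat (Suc N) * (2 * \<tau>))))"
      by (simp only: prod.lessThan_Suc Suc) simp
    also have "ee (- of_nat (N * Suc N) * \<tau>) * ee (- (of_nat (Suc N) * (2 * \<tau>))) = ee (- of_nat (Suc N * Suc (Suc N)) * \<tau>)"
      unfolding ee_add[symmetric] by (rule arg_cong[where f = ee]) (simp add: algebra_simps)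
    finally show ?case .
  qed simp
  finally show ?thesis .
qed

text \<open>The derivative of \<open>\<Prod>\<^bsub>i<2N\<^esub> (1 - x q\<^sup>i)\<close> at its simple zero \<open>x = q\<^bsup>-N\<^esup>\<close> is computed in two ways, from
the product and from the \<open>q\<close>-binomial expansion.  Since the expansion itself vanishes there, the
weight \<open>k\<close> that the derivative produces may be replaced by \<open>k - N\<close>.\<close>

lemma finite_jacobi:
  fixes \<tau> :: complex
  assumes \<tau>: "Im \<tau> > 0"
  defines "q \<equiv> ee (2 * \<tau>)"
  defines "J \<equiv> \<lambda>n::int. ee (of_int n + (of_int n ^ 2 - of_int n) * \<tau>)"
  shows "(\<Sum>k\<le>2 * Suc N. of_int (int k - int (Suc N)) * J (int k - int (Suc N)) * qbin q (2 * Suc N) k) =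
           - qfac q (Suc N) * qfac q N"
proof -
  have q: "norm q < 1" using \<tau> by (simp add: q_def norm_ee)
  have q0: "q \<noteq> 0" by (simp add: q_def)
  define K where "K = Suc N"
  define x0 where "x0 = inverse (q ^ K)"
  define E where "E = (-1) ^ K * ee (- of_nat (K * Suc K) * \<tau>)"
  have E0: "E \<noteq> 0" by (simp add: E_def)
  define c where "c k = (-1) ^ k * q ^ (k choose 2) * qbin q (2 * K) k" for k
  have c: "c k * x0 ^ k = E * J (int k - int K) * qbin q (2 * K) k" for k
    using finite_jacobi_term[of k \<tau> K] by (simp add: c_def x0_def E_def J_def q_def mult_ac)
  define R where "R x = (\<Prod>i\<in>{..<2 * K} - {K}. 1 - x * q ^ i)" for x
  have fact: "(\<Sum>k\<le>2 * K. c k * x ^ k) = (1 - x * q ^ K) * R x" for x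
  proof -
    have "(\<Sum>k\<le>2 * K. c k * x ^ k) = (\<Prod>i<2 * K. 1 - x * q ^ i)"
      using qbinomial[OF q, of x "2 * K"] by (simp add: c_def)
    also have "\<dots> = (1 - x * q ^ K) * R x"
      unfolding R_def by (rule prod.remove) (auto simp: K_def)
    finally show ?thesis .
  qed
  have zero: "(\<Sum>k\<le>2 * K. c k * x0 ^ k) = 0"
    unfolding fact using q0 by (simp add: x0_def)
  have "((\<lambda>x. \<Sum>k\<le>2 * K. c k * x ^ k) has_field_derivative (\<Sum>k\<le>2 * K. c k * (of_nat k * x0 ^ (k - 1)))) (at x0)"
    by (auto intro!: derivative_eq_intros sum.cong)
  moreover have "((\<lambda>x. \<Sum>k\<le>2 * K. c k * x ^ k) has_field_derivative (- (q ^ K) * R x0)) (at x0)"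
  proof -
    have "R field_differentiable at x0"
      unfolding R_def[abs_def]
      by (rule holomorphic_on_imp_differentiable_at[of _ UNIV]; (intro holomorphic_intros)?; simp)
    then obtain R' where "(R has_field_derivative R') (at x0)" by (auto simp: field_differentiable_def)
    then have "((\<lambda>x. (1 - x * q ^ K) * R x) has_field_derivative (- (q ^ K) * R x0)) (at x0)"
      using q0 by (auto intro!: derivative_eq_intros simp: x0_def)
    then show ?thesis by (simp add: fact)
  qed
  ultimately have "(\<Sum>k\<le>2 * K. c k * (of_nat k * x0 ^ (k - 1))) = - (q ^ K) * R x0"
    by (rule DERIV_unique)
  then have "x0 * (\<Sum>k\<le>2 * K. c k * (of_nat k * x0 ^ (k - 1))) = - R x0"
    using q0 by (simp add: x0_def)
  moreover have "x0 * (\<Sum>k\<le>2 * K. c k * (of_nat k * x0 ^ (k - 1))) = (\<Sum>k\<le>2 * K. of_nat k * (c k * x0 ^ k))"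
  proof -
    have "x0 * (c k * (of_nat k * x0 ^ (k - 1))) = of_nat k * (c k * x0 ^ k)" for k
      by (cases k) auto
    then show ?thesis by (simp only: sum_distrib_left)
  qed
  ultimately have der: "(\<Sum>k\<le>2 * K. of_nat k * (c k * x0 ^ k)) = - R x0" by simp
  have "E * (\<Sum>k\<le>2 * K. of_int (int k - int K) * J (int k - int K) * qbin q (2 * K) k) =
        (\<Sum>k\<le>2 * K. of_nat k * (c k * x0 ^ k)) - of_nat K * (\<Sum>k\<le>2 * K. c k * x0 ^ k)"
    unfolding c by (simp add: sum_distrib_left sum_subtractf [symmetric] algebra_simps)
  also have "\<dots> = - R x0" unfolding der zero by simp
  also have "R x0 = E * (qfac q K * qfac q N)"
  proof -
    have "{..<2 * K} - {K} = {..<K} \<union> (\<lambda>i. i + Suc K) ` {..<N}"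
    proof (intro set_eqI iffI)
      fix i assume i: "i \<in> {..<2 * K} - {K}"
      show "i \<in> {..<K} \<union> (\<lambda>i. i + Suc K) ` {..<N}"
      proof (cases "i < K")
        case False
        then have "i = (i - Suc K) + Suc K" "i - Suc K \<in> {..<N}" using i by (auto simp: K_def)
        then show ?thesis by blast
      qed simp
    qed (auto simp: K_def)
    then have "R x0 = (\<Prod>i\<in>{..<K}. 1 - x0 * q ^ i) * (\<Prod>i\<in>(\<lambda>i. i + Suc K) ` {..<N}. 1 - x0 * q ^ i)"
      unfolding R_def by (simp only:) (intro prod.union_disjoint; force)
    also have "(\<Prod>i\<in>(\<lambda>i. i + Suc K) ` {..<N}. 1 - x0 * q ^ i) = qfac q N"
    proof -
      have "(\<Prod>i\<in>(\<lambda>i. i + Suc K) ` {..<N}. 1 - x0 * q ^ i) = (\<Prod>i<N. 1 - x0 * q ^ (i + Suc K))"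
        by (subst prod.reindex) (auto simp: inj_on_def)
      also have "\<dots> = qfac q N"
        unfolding qfac_def using q0 by (intro prod.cong) (auto simp: x0_def power_add field_simps)
      finally show ?thesis .
    qed
    also have "(\<Prod>i\<in>{..<K}. 1 - x0 * q ^ i) = E * qfac q K"
      using prod_reflect_qfac[of \<tau> K] by (simp add: x0_def E_def q_def)
    finally show ?thesis by simp
  qed
  finally have "E * (\<Sum>k\<le>2 * K. of_int (int k - int K) * J (int k - int K) * qbin q (2 * K) k) =
      E * (- qfac q K * qfac q N)"
    by (simp only: mult_minus_left mult_minus_right)
  then show ?thesis using E0 unfolding K_def mult_cancel_left by blast
qed

text \<open>Dominated convergence for series over an arbitrary index type, here needed for the integers.\<close>

lemma tendsto_infsum_dominated:
  fixes f :: "'i \<Rightarrow> nat \<Rightarrow> complex"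
  assumes lim: "\<And>i. (f i \<longlonglongrightarrow> g i)" and bound: "\<And>i n. norm (f i n) \<le> M i" and M: "M summable_on UNIV"
  shows "(\<lambda>n. \<Sum>\<^sub>\<infinity>i. f i n) \<longlonglongrightarrow> (\<Sum>\<^sub>\<infinity>i. g i)"
proof (rule swap_uniform_limit')
  show "uniform_limit UNIV (\<lambda>X n. \<Sum>i\<in>X. f i n) (\<lambda>n. \<Sum>\<^sub>\<infinity>i. f i n) (finite_subsets_at_top UNIV)"
    by (rule Weierstrass_m_test_general) (use bound M in auto)
  show "\<forall>\<^sub>F X in finite_subsets_at_top UNIV. (\<lambda>n. \<Sum>i\<in>X. f i n) \<longlonglongrightarrow> (\<Sum>i\<in>X. g i)"
    by (intro always_eventually allI tendsto_sum lim)
  have "norm (g i) \<le> M i" for i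
    by (rule tendsto_upperbound[OF tendsto_norm[OF lim]]) (use bound in auto)
  then have "g summable_on UNIV"
    by (intro abs_summable_summable[OF summable_on_comparison_test[OF M]]) simp_all
  then show "((\<lambda>X. \<Sum>i\<in>X. g i) \<longlongrightarrow> (\<Sum>\<^sub>\<infinity>i. g i)) (finite_subsets_at_top UNIV)"
    by (simp add: infsum_tendsto)
qed auto

lemma euler_product:
  assumes q: "norm (q :: complex) < 1"
  shows "qfac q \<longlonglongrightarrow> (\<Prod>n. 1 - q ^ Suc n)" "(\<Prod>n. 1 - q ^ Suc n) \<noteq> 0"
proof -
  have "summable (\<lambda>n. norm (q ^ n))"
    using q by (simp add: norm_power summable_geometric)
  then have "summable (\<lambda>n. norm ((1 - q ^ Suc n) - 1))"
    by (subst (asm) summable_Suc_iff [symmetric]) simp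
  then have conv: "convergent_prod (\<lambda>n. 1 - q ^ Suc n)"
    by (intro abs_convergent_prod_imp_convergent_prod summable_imp_abs_convergent_prod)
  show "(\<Prod>n. 1 - q ^ Suc n) \<noteq> 0"
    by (rule prodinf_nonzero[OF conv]) (use power_neq_1[OF q] in simp)
  have "(\<lambda>n. qfac q (Suc n)) \<longlonglongrightarrow> (\<Prod>n. 1 - q ^ Suc n)"
    using convergent_prod_LIMSEQ[OF conv] by (simp add: qfac_def lessThan_Suc_atMost)
  then show "qfac q \<longlonglongrightarrow> (\<Prod>n. 1 - q ^ Suc n)"
    by (simp add: filterlim_sequentially_Suc)
qed

text \<open>The limit \<open>N \<rightarrow> \<infinity>\<close> of the finite identity: the Gaussian binomial coefficients are bounded and tend to
\<open>1 / \<Prod>(1 - q\<^sup>n)\<close>.\<close>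

lemma jacobi_cube:
  fixes \<tau> :: complex
  assumes \<tau>: "Im \<tau> > 0"
  shows "(\<Sum>\<^sub>\<infinity>n::int. of_int n * ee (of_int n + (of_int n ^ 2 - of_int n) * \<tau>)) =
           - ((\<Prod>n. 1 - ee (2 * \<tau>) ^ Suc n) ^ 3)"
proof -
  define q where "q = ee (2 * \<tau>)"
  have q: "norm q < 1" using \<tau> by (simp add: q_def norm_ee)
  define P where "P = (\<Prod>n. 1 - q ^ Suc n)"
  note P = euler_product[OF q, folded P_def]
  define J where "J n = ee (of_int n + (of_int n ^ 2 - of_int n) * \<tau>)" for n :: int
  \<comment> \<open>extension by zero, so that the finite sums run over all integers\<close>
  define b where "b n N = (if \<bar>n\<bar> \<le> int (Suc N) then qbin q (2 * Suc N) (nat (int (Suc N) + n)) else 0)" for n N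
  have fin: "(\<Sum>\<^sub>\<infinity>n. of_int n * J n * b n N) = - qfac q (Suc N) * qfac q N" for N
  proof -
    have "(\<Sum>\<^sub>\<infinity>n. of_int n * J n * b n N) = (\<Sum>\<^sub>\<infinity>n\<in>{-int (Suc N)..int (Suc N)}. of_int n * J n * b n N)"
      by (rule infsum_cong_neutral) (auto simp: b_def)
    also have "\<dots> = (\<Sum>n\<in>{-int (Suc N)..int (Suc N)}. of_int n * J n * b n N)"
      by simp
    also have "\<dots> = (\<Sum>k\<le>2 * Suc N. of_int (int k - int (Suc N)) * J (int k - int (Suc N)) * qbin q (2 * Suc N) k)"
      by (rule sum.reindex_bij_witness[of _ "\<lambda>k. int k - int (Suc N)" "\<lambda>n. nat (int (Suc N) + n)"])
        (auto simp: b_def)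
    also have "\<dots> = - qfac q (Suc N) * qfac q N"
      using finite_jacobi[OF \<tau>, of N] by (simp add: J_def q_def)
    finally show ?thesis .
  qed
  have "Bseq (qfac q)" using P(1) by (intro convergent_imp_Bseq) (auto simp: convergent_def)
  then obtain B where B: "B > 0" "\<And>n. norm (qfac q n) \<le> B" by (auto elim: BseqE)
  have "(\<lambda>n. inverse (qfac q n)) \<longlonglongrightarrow> inverse P" by (intro tendsto_inverse P)
  then have "Bseq (\<lambda>n. inverse (qfac q n))" by (intro convergent_imp_Bseq) (auto simp: convergent_def)
  then obtain D where D: "D > 0" "\<And>n. norm (inverse (qfac q n)) \<le> D" by (auto elim: BseqE)
  have bb: "norm (b n N) \<le> B * (D * D)" for n N
  proof -
    have "norm (qfac q i / (qfac q j * qfac q k)) \<le> B * (D * D)" for i j k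
      using mult_mono[OF B(2)[of i] mult_mono[OF D(2)[of j] D(2)[of k]]] B(1) D(1)
      by (simp add: norm_divide norm_mult divide_inverse norm_inverse)
    then show ?thesis using B(1) D(1) by (simp add: b_def qbin_def)
  qed
  have blim: "b n \<longlonglongrightarrow> inverse P" for n
  proof -
    have "(\<lambda>N. qfac q (2 * Suc N) / (qfac q (nat (int (Suc N) + n)) * qfac q (nat (int (Suc N) - n)))) \<longlonglongrightarrow> P / (P * P)"
    proof (intro tendsto_intros)
      show "(\<lambda>N. qfac q (2 * Suc N)) \<longlonglongrightarrow> P"
        using LIMSEQ_subseq_LIMSEQ[OF P(1), of "\<lambda>N. 2 * Suc N"] by (simp add: strict_mono_def o_def)
      have *: "filterlim (\<lambda>N. nat (int (Suc N) + m)) sequentially sequentially" for m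
        unfolding filterlim_at_top eventually_sequentially
      proof
        fix Z show "\<exists>N. \<forall>n\<ge>N. Z \<le> nat (int (Suc n) + m)"
          by (rule exI[of _ "Z + nat \<bar>m\<bar>"]) auto
      qed
      show "(\<lambda>N. qfac q (nat (int (Suc N) + n))) \<longlonglongrightarrow> P"
        by (rule filterlim_compose[OF P(1) *])
      show "(\<lambda>N. qfac q (nat (int (Suc N) - n))) \<longlonglongrightarrow> P"
        using filterlim_compose[OF P(1) *[of "- n"]] by simp
    qed (use P in auto)
    moreover have "eventually (\<lambda>N. qfac q (2 * Suc N) / (qfac q (nat (int (Suc N) + n)) * qfac q (nat (int (Suc N) - n))) = b n N) sequentially"
      unfolding eventually_sequentially
    proof (intro exI allI impI)
      fix N assume "nat \<bar>n\<bar> \<le> N"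
      then have n: "\<bar>n\<bar> \<le> int (Suc N)" by simp
      then have "2 * Suc N - nat (int (Suc N) + n) = nat (int (Suc N) - n)" "nat (int (Suc N) + n) \<le> 2 * Suc N"
        by auto
      then show "qfac q (2 * Suc N) / (qfac q (nat (int (Suc N) + n)) * qfac q (nat (int (Suc N) - n))) = b n N"
        using n unfolding b_def qbin_def by simp
    qed
    ultimately have "b n \<longlonglongrightarrow> P / (P * P)" by (rule Lim_transform_eventually)
    moreover have "P / (P * P) = inverse P" using P(2) by (simp add: field_simps)
    ultimately show ?thesis by simp
  qed
  define M where "M = (\<lambda>n::int. exp (- (pi * Im \<tau>) * of_int n ^ 2 + (pi * Im \<tau> + 1) * \<bar>of_int n\<bar>) * (B * (D * D)))"
  have Jb: "norm (of_int n * J n) \<le> exp (- (pi * Im \<tau>) * of_int n ^ 2 + (pi * Im \<tau> + 1) * \<bar>of_int n\<bar>)" for n :: int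
  proof -
    have "norm (J n) \<le> exp (- (pi * Im \<tau>) * of_int n ^ 2 + (pi * Im \<tau>) * \<bar>of_int n\<bar>)"
      using norm_ee_quadratic_le[of "1 - \<tau>" "Im \<tau>" 0 0 \<tau> n] \<tau> by (simp add: J_def algebra_simps)
    moreover have "norm (of_int n :: complex) \<le> exp \<bar>of_int n\<bar>"
      using exp_ge_add_one_self[of "\<bar>of_int n :: real\<bar>"] by (simp add: norm_of_int del: exp_ge_add_one_self) 
    ultimately have "norm (of_int n :: complex) * norm (J n) \<le> exp \<bar>of_int n\<bar> * exp (- (pi * Im \<tau>) * of_int n ^ 2 + (pi * Im \<tau>) * \<bar>of_int n\<bar>)"
      by (intro mult_mono) auto
    then show ?thesis by (simp add: norm_mult exp_add [symmetric] algebra_simps)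
  qed
  have "(\<lambda>N. \<Sum>\<^sub>\<infinity>n. of_int n * J n * b n N) \<longlonglongrightarrow> (\<Sum>\<^sub>\<infinity>n. of_int n * J n * inverse P)"
  proof (rule tendsto_infsum_dominated[where M = M])
    show "M summable_on UNIV"
      unfolding M_def by (intro summable_on_cmult_left gaussian_summable) (use \<tau> in simp)
    show "norm (of_int n * J n * b n N) \<le> M n" for n N
      unfolding M_def norm_mult[of "of_int n * J n"] by (intro mult_mono Jb bb) auto
  qed (intro tendsto_intros blim)
  moreover have "(\<lambda>N. \<Sum>\<^sub>\<infinity>n. of_int n * J n * b n N) \<longlonglongrightarrow> - P * P"
    unfolding fin by (intro tendsto_intros P LIMSEQ_Suc)
  ultimately have "(\<Sum>\<^sub>\<infinity>n. of_int n * J n * inverse P) = - P * P"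
    by (rule LIMSEQ_unique)
  moreover have "(\<Sum>\<^sub>\<infinity>n. of_int n * J n * inverse P) = (\<Sum>\<^sub>\<infinity>n. of_int n * J n) * inverse P"
    by (rule infsum_cmult_left')
  ultimately show ?thesis using P(2) by (simp add: P_def J_def q_def field_simps power3_eq_cube)
qed

section \<open>Geometric expansions in a strip\<close>

text \<open>The coefficient of \<open>u\<^sup>l q\<^bsup>jl\<^esup>\<close> in the expansion of \<open>1 / (1 - u q\<^sup>j)\<close> for \<open>|q| < |u| < 1\<close>.  It is
\<open>1\<close> if \<open>j, l \<ge> 0\<close>, it is \<open>-1\<close> if \<open>j, l < 0\<close>, and \<open>0\<close> otherwise.  The additive form makes the
cancellations between several such coefficients a matter of linear algebra.\<close>

definition dsgn :: "int \<Rightarrow> int \<Rightarrow> complex" where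
  "dsgn j l = of_bool (0 \<le> j) + of_bool (0 \<le> l) - 1"

lemma has_sum_nat_geometric:
  assumes "Im \<zeta> > 0"
  shows "((\<lambda>n::nat. ee (of_nat n * \<zeta>)) has_sum 1 / (1 - ee \<zeta>)) UNIV"
proof (rule norm_summable_imp_has_sum)
  have lt: "norm (ee \<zeta>) < 1" using assms by (simp add: norm_ee)
  show "summable (\<lambda>n. norm (ee (of_nat n * \<zeta>)))"
    unfolding ee_of_nat_mult norm_power using lt by (intro summable_geometric) simp
  show "(\<lambda>n. ee (of_nat n * \<zeta>)) sums (1 / (1 - ee \<zeta>))"
    unfolding ee_of_nat_mult using lt by (rule geometric_sums)
qed

lemma has_sum_dsgn_geometric:
  assumes "if 0 \<le> j then Im \<zeta> > 0 else Im \<zeta> < 0"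
  shows "((\<lambda>l. dsgn j l * ee (of_int l * \<zeta>)) has_sum 1 / (1 - ee \<zeta>)) UNIV"
proof (cases "0 \<le> j")
  case True
  have "((\<lambda>l::int. ee (of_int l * \<zeta>)) has_sum 1 / (1 - ee \<zeta>)) (range int)"
    by (subst has_sum_reindex) (use has_sum_nat_geometric[of \<zeta>] True assms in \<open>auto simp: o_def\<close>)
  moreover have "l \<in> range int" if "0 \<le> l" for l using that nonneg_int_cases by blast
  ultimately show ?thesis
    by (subst has_sum_cong_neutral[of "range int" UNIV]) (use True in \<open>auto simp: dsgn_def\<close>)
next
  case False
  then have lt: "Im (- \<zeta>) > 0" using assms by simp
  have "((\<lambda>n::nat. - ee (- \<zeta>) * ee (of_nat n * (- \<zeta>))) has_sum - ee (- \<zeta>) * (1 / (1 - ee (- \<zeta>)))) UNIV"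
    by (intro has_sum_cmult_right has_sum_nat_geometric lt)
  also have "(\<lambda>n::nat. - ee (- \<zeta>) * ee (of_nat n * (- \<zeta>))) = (\<lambda>l::int. - ee (of_int l * \<zeta>)) \<circ> (\<lambda>n. - int n - 1)"
  proof
    fix n :: nat
    have "ee (- \<zeta>) * ee (of_nat n * (- \<zeta>)) = ee (of_int (- int n - 1) * \<zeta>)"
      unfolding ee_add[symmetric] by (rule arg_cong[where f = ee]) (simp add: algebra_simps)
    then show "- ee (- \<zeta>) * ee (of_nat n * (- \<zeta>)) = ((\<lambda>l::int. - ee (of_int l * \<zeta>)) \<circ> (\<lambda>n. - int n - 1)) n"
      by (simp only: o_def mult_minus_left)
  qed
  also have "- ee (- \<zeta>) * (1 / (1 - ee (- \<zeta>))) = 1 / (1 - ee \<zeta>)"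
  proof -
    have "norm (ee (- \<zeta>)) < 1" using lt by (simp add: norm_ee mult_pos_neg)
    then have "ee (- \<zeta>) \<noteq> 1" by auto
    then show ?thesis by (simp add: ee_minus field_simps)
  qed
  finally have "((\<lambda>l::int. - ee (of_int l * \<zeta>)) has_sum 1 / (1 - ee \<zeta>)) (range (\<lambda>n. - int n - 1))"
    by (subst has_sum_reindex) (auto simp: inj_on_def o_def)
  also have "range (\<lambda>n. - int n - 1) = {..<0}"
  proof (intro equalityI subsetI)
    fix l :: int assume "l \<in> {..<0}"
    then have "l = - int (nat (- l - 1)) - 1" by simp
    then show "l \<in> range (\<lambda>n. - int n - 1)" by blast
  qed auto
  also have "((\<lambda>l::int. - ee (of_int l * \<zeta>)) has_sum 1 / (1 - ee \<zeta>)) {..<0} \<longleftrightarrow> ?thesis"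
    by (rule has_sum_cong_neutral) (use False in \<open>auto simp: dsgn_def\<close>)
  finally show ?thesis .
qed

text \<open>For fixed \<open>j\<close> all nonzero coefficients have the same sign, so the series of norms is, up to this
sign, the same geometric series at the purely imaginary point with the same imaginary part.\<close>

lemma has_sum_norm_dsgn_geometric:
  assumes "if 0 \<le> j then Im \<zeta> > 0 else Im \<zeta> < 0"
  shows "((\<lambda>l. norm (dsgn j l * ee (of_int l * \<zeta>))) has_sum norm (1 / (1 - ee (\<i> * Im \<zeta>)))) UNIV"
proof -
  \<comment> \<open>the common sign of the nonzero coefficients\<close>
  define s :: complex where "s = (if 0 \<le> j then 1 else -1)"
  have "((\<lambda>l. s * (dsgn j l * ee (of_int l * (\<i> * Im \<zeta>)))) has_sum s * (1 / (1 - ee (\<i> * Im \<zeta>)))) UNIV"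
    using assms by (intro has_sum_cmult_right has_sum_dsgn_geometric) auto
  also have "(\<lambda>l. s * (dsgn j l * ee (of_int l * (\<i> * Im \<zeta>)))) = (\<lambda>l. of_real (norm (dsgn j l * ee (of_int l * \<zeta>))))"
  proof
    fix l
    have "ee (of_int l * (\<i> * Im \<zeta>)) = of_real (norm (ee (of_int l * \<zeta>)))"
      unfolding norm_ee by (simp add: ee_def exp_of_real mult_ac flip: exp_of_real)
    then show "s * (dsgn j l * ee (of_int l * (\<i> * Im \<zeta>))) = of_real (norm (dsgn j l * ee (of_int l * \<zeta>)))"
      by (auto simp: s_def dsgn_def norm_mult)
  qed
  finally have *: "((\<lambda>l. complex_of_real (norm (dsgn j l * ee (of_int l * \<zeta>)))) has_sum s * (1 / (1 - ee (\<i> * Im \<zeta>)))) UNIV" .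
  from has_sum_Re[OF this]
  have R: "((\<lambda>l. norm (dsgn j l * ee (of_int l * \<zeta>))) has_sum Re (s * (1 / (1 - ee (\<i> * Im \<zeta>))))) UNIV" by simp
  then have "complex_of_real (Re (s * (1 / (1 - ee (\<i> * Im \<zeta>))))) = s * (1 / (1 - ee (\<i> * Im \<zeta>)))"
    using has_sum_unique[OF has_sum_of_real[OF R, where 'a = complex] *] by simp
  moreover have "Re (s * (1 / (1 - ee (\<i> * Im \<zeta>)))) \<ge> 0"
    using R by (rule has_sum_nonneg) simp
  ultimately have "Re (s * (1 / (1 - ee (\<i> * Im \<zeta>)))) = norm (s * (1 / (1 - ee (\<i> * Im \<zeta>))))"
    by (metis abs_of_nonneg norm_of_real)
  also have "\<dots> = norm (1 / (1 - ee (\<i> * Im \<zeta>)))"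
    unfolding norm_mult by (simp add: s_def)
  finally show ?thesis using R by simp
qed

lemma has_sum_SigmaI_norm:
  fixes f :: "'a \<times> 'b \<Rightarrow> complex"
  assumes norm: "\<And>x. x \<in> A \<Longrightarrow> ((\<lambda>y. norm (f (x, y))) has_sum G x) (B x)" and G: "G summable_on A"
    and f: "\<And>x. x \<in> A \<Longrightarrow> ((\<lambda>y. f (x, y)) has_sum g x) (B x)"
  shows "(\<lambda>z. norm (f z)) summable_on Sigma A B" "(f has_sum (\<Sum>\<^sub>\<infinity>x\<in>A. g x)) (Sigma A B)"
proof -
  show norm': "(\<lambda>z. norm (f z)) summable_on Sigma A B"
    by (rule summable_on_SigmaI[OF norm G]) auto
  have "norm (g x) \<le> G x" if "x \<in> A" for x
    using norm_infsum_le[OF f[OF that] norm[OF that]] by simp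
  then have "g summable_on A"
    by (intro abs_summable_summable[OF summable_on_comparison_test[OF G]]) simp_all
  then show "(f has_sum (\<Sum>\<^sub>\<infinity>x\<in>A. g x)) (Sigma A B)"
    by (intro has_sum_SigmaI[OF f has_sum_infsum] abs_summable_summable[OF norm'])
qed

lemma has_sum_product:
  fixes f :: "'a \<Rightarrow> complex" and g :: "'b \<Rightarrow> complex"
  assumes f: "(\<lambda>x. norm (f x)) summable_on UNIV" and g: "(\<lambda>y. norm (g y)) summable_on UNIV"
  shows "(\<lambda>(x, y). norm (f x * g y)) summable_on UNIV"
    and "((\<lambda>(x, y). f x * g y) has_sum infsum f UNIV * infsum g UNIV) UNIV"
proof -
  have 1: "((\<lambda>y. norm (case (x, y) of (x, y) \<Rightarrow> f x * g y)) has_sum norm (f x) * (\<Sum>\<^sub>\<infinity>y. norm (g y))) UNIV" for x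
    using has_sum_cmult_right[OF has_sum_infsum[OF g]] by (simp add: norm_mult)
  have 2: "((\<lambda>y. case (x, y) of (x, y) \<Rightarrow> f x * g y) has_sum f x * infsum g UNIV) UNIV" for x
    using has_sum_cmult_right[OF has_sum_infsum[OF abs_summable_summable[OF g]]] by simp
  have 3: "(\<lambda>x. norm (f x) * (\<Sum>\<^sub>\<infinity>y. norm (g y))) summable_on UNIV"
    by (rule summable_on_cmult_left[OF f])
  note * = has_sum_SigmaI_norm[of UNIV "\<lambda>(x, y). f x * g y", OF 1 3 2]
  show "(\<lambda>(x, y). norm (f x * g y)) summable_on UNIV"
    using *(1) by (simp add: case_prod_unfold)
  show "((\<lambda>(x, y). f x * g y) has_sum infsum f UNIV * infsum g UNIV) UNIV"
    using *(2) by (simp add: infsum_cmult_left')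
qed

text \<open>Absolute convergence of the double series only needs the summability of the simple series at
purely imaginary arguments, which is again a series with denominators of the same type.  The
function \<open>\<sigma>\<close> allows for arguments in a translate of the strip.\<close>

lemma dsgn_expansion:
  fixes c \<zeta> :: "int \<Rightarrow> complex"
  assumes \<zeta>: "\<And>j. if 0 \<le> \<sigma> j then Im (\<zeta> j) > 0 else Im (\<zeta> j) < 0"
    and c: "(\<lambda>j. norm (c j / (1 - ee (\<i> * Im (\<zeta> j))))) summable_on UNIV"
  shows "(\<lambda>(j, l). norm (c j * (dsgn (\<sigma> j) l * ee (of_int l * \<zeta> j)))) summable_on UNIV"
    and "((\<lambda>(j, l). c j * (dsgn (\<sigma> j) l * ee (of_int l * \<zeta> j))) has_sum (\<Sum>\<^sub>\<infinity>j. c j / (1 - ee (\<zeta> j)))) UNIV"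
proof -
  define f where "f = (\<lambda>(j, l). c j * (dsgn (\<sigma> j) l * ee (of_int l * \<zeta> j)))"
  have 1: "((\<lambda>l. norm (f (j, l))) has_sum norm (c j / (1 - ee (\<i> * Im (\<zeta> j))))) UNIV" for j
    using has_sum_cmult_right[OF has_sum_norm_dsgn_geometric[OF \<zeta>[of j]], of "norm (c j)"]
    by (simp add: f_def norm_mult norm_divide)
  have 2: "((\<lambda>l. f (j, l)) has_sum c j / (1 - ee (\<zeta> j))) UNIV" for j
    using has_sum_cmult_right[OF has_sum_dsgn_geometric[OF \<zeta>[of j]], of "c j"] by (simp add: f_def)
  note * = has_sum_SigmaI_norm[of UNIV f, OF 1 c 2]
  show "(\<lambda>(j, l). norm (c j * (dsgn (\<sigma> j) l * ee (of_int l * \<zeta> j)))) summable_on UNIV"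
    using *(1) by (simp add: f_def case_prod_unfold)
  show "((\<lambda>(j, l). c j * (dsgn (\<sigma> j) l * ee (of_int l * \<zeta> j))) has_sum (\<Sum>\<^sub>\<infinity>j. c j / (1 - ee (\<zeta> j)))) UNIV"
    using *(2) by (simp add: f_def)
qed

lemma lerch_expansion:
  fixes A B C z \<tau> :: complex
  assumes z: "0 < Im z" "Im z < Im \<tau>" and A: "Im A > 0"
  defines "c \<equiv> \<lambda>j::int. ee (A * of_int j ^ 2 + B * of_int j + C)"
  shows "(\<lambda>(j, l). norm (c j * (dsgn j l * ee (of_int l * (2 * (z + of_int j * \<tau>)))))) summable_on UNIV"
    and "((\<lambda>(j, l). c j * (dsgn j l * ee (of_int l * (2 * (z + of_int j * \<tau>)))))
            has_sum (\<Sum>\<^sub>\<infinity>j. c j / (1 - ee (2 * (z + of_int j * \<tau>))))) UNIV"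
proof -
  have \<tau>: "Im \<tau> > 0" using z by simp
  have 1: "if 0 \<le> j then Im (2 * (z + of_int j * \<tau>)) > 0 else Im (2 * (z + of_int j * \<tau>)) < 0" for j
  proof (cases "0 \<le> j")
    case True
    then show ?thesis using z \<tau> by (simp add: add_pos_nonneg)
  next
    case False
    then have "of_int j * Im \<tau> \<le> (-1) * Im \<tau>" using \<tau> by (intro mult_right_mono) auto
    then show ?thesis using False z by simp
  qed
  have 2: "(\<lambda>j. norm (c j / (1 - ee (\<i> * Im (2 * (z + of_int j * \<tau>)))))) summable_on UNIV"
  proof -
    have "\<i> * Im z \<notin> period_lattice (\<i> * Im \<tau>)" using z by (intro strip_not_in_lattice) auto
    from lerch_summable[OF _ A this, of B C] \<tau>
    show ?thesis by (simp add: c_def algebra_simps)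
  qed
  show "(\<lambda>(j, l). norm (c j * (dsgn j l * ee (of_int l * (2 * (z + of_int j * \<tau>)))))) summable_on UNIV"
    and "((\<lambda>(j, l). c j * (dsgn j l * ee (of_int l * (2 * (z + of_int j * \<tau>)))))
            has_sum (\<Sum>\<^sub>\<infinity>j. c j / (1 - ee (2 * (z + of_int j * \<tau>))))) UNIV"
    using dsgn_expansion[of "\<lambda>j. j" "\<lambda>j. 2 * (z + of_int j * \<tau>)" c, OF 1 2] by auto
qed

text \<open>The terms decay like \<open>|u|\<^sup>k\<close> for \<open>k \<rightarrow> \<infinity>\<close>.  For \<open>k \<rightarrow> -\<infinity>\<close> the denominator grows like \<open>|q|\<^sup>k\<close>, and
the terms decay like \<open>|u/q|\<^sup>k\<close>.\<close>

lemma kronecker_summable: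
  assumes a: "0 < Im a" "Im a < Im \<tau>" and b: "b \<notin> period_lattice \<tau>"
  shows "(\<lambda>k::int. norm (ee (2 * of_int k * a) / (1 - ee (2 * (b + of_int k * \<tau>))))) summable_on UNIV"
proof -
  have \<tau>: "Im \<tau> > 0" using a by simp
  have bound: "\<exists>\<delta>>0. \<forall>k. \<delta> \<le> norm (1 - ee (2 * (c + of_int k * \<tau>)))" if c: "c \<notin> period_lattice \<tau>" for c
  proof -
    obtain \<delta> where "\<delta> > 0" "\<And>t k. t \<in> {c} \<Longrightarrow> \<delta> \<le> norm (1 - ee (2 * (t + of_int k * \<tau>)))"
      using denom_lower_bound[OF \<tau>, of "{c}" "\<lambda>t. t"] c by auto
    then show ?thesis by blast
  qed
  obtain \<delta> where \<delta>: "\<delta> > 0" "\<And>k. \<delta> \<le> norm (1 - ee (2 * (b + of_int k * \<tau>)))"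
    using bound[OF b] by blast
  have "- b \<notin> period_lattice \<tau>" using b by (simp add: period_lattice_uminus)
  from bound[OF this] obtain \<delta>' where \<delta>': "\<delta>' > 0" "\<And>k. \<delta>' \<le> norm (1 - ee (2 * (- b + of_int k * \<tau>)))"
    by blast
  define \<epsilon> where "\<epsilon> = 2 * pi * min (Im a) (Im \<tau> - Im a)"
  have \<epsilon>: "\<epsilon> > 0" using a by (simp add: \<epsilon>_def)
  define C where "C = max (inverse \<delta>) (inverse \<delta>' * norm (ee (- 2 * b)))"
  have C0: "C \<ge> 0" using \<delta>(1) by (simp add: C_def le_max_iff_disj)
  have bound: "norm (ee (2 * of_int k * a) / (1 - ee (2 * (b + of_int k * \<tau>)))) \<le> C * exp (- (\<epsilon> * \<bar>of_int k\<bar>))" for k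
  proof (cases "0 \<le> k")
    case True
    have "norm (ee (2 * of_int k * a)) \<le> exp (- (\<epsilon> * \<bar>of_int k\<bar>))"
    proof -
      have "\<epsilon> * of_int k \<le> 2 * pi * Im a * of_int k"
        using True by (intro mult_right_mono) (auto simp: \<epsilon>_def)
      then show ?thesis using True by (simp add: norm_ee mult_ac)
    qed
    then have "norm (ee (2 * of_int k * a) / (1 - ee (2 * (b + of_int k * \<tau>)))) \<le> exp (- (\<epsilon> * \<bar>of_int k\<bar>)) / \<delta>"
      unfolding norm_divide using \<delta> by (intro frac_le) auto
    also have "\<dots> = inverse \<delta> * exp (- (\<epsilon> * \<bar>of_int k\<bar>))" by (simp add: field_simps)
    also have "\<dots> \<le> C * exp (- (\<epsilon> * \<bar>of_int k\<bar>))" by (intro mult_right_mono) (auto simp: C_def)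
    finally show ?thesis .
  next
    case False
    define X where "X = ee (2 * (b + of_int k * \<tau>))"
    have X: "inverse X = ee (2 * (- b + of_int (- k) * \<tau>))"
      unfolding X_def ee_minus[symmetric] by (simp add: algebra_simps)
    have X0: "X \<noteq> 0" by (simp add: X_def)
    have "1 - X \<noteq> 0" unfolding X_def by (rule not_in_lattice_denom[OF b])
    then have "ee (2 * of_int k * a) / (1 - X) = - (inverse X * ee (2 * of_int k * a)) / (1 - inverse X)"
      using X0 by (simp add: field_simps)
    then have "norm (ee (2 * of_int k * a) / (1 - X)) = norm (inverse X * ee (2 * of_int k * a)) / norm (1 - inverse X)"
      by (simp add: norm_divide)
    also have "\<dots> \<le> norm (inverse X * ee (2 * of_int k * a)) / \<delta>'"
      using \<delta>'(1) \<delta>'(2)[of "- k"] unfolding X by (intro frac_le) auto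
    also have "inverse X * ee (2 * of_int k * a) = ee (- 2 * b) * ee (2 * of_int k * (a - \<tau>))"
      unfolding X ee_add[symmetric] by (rule arg_cong[where f = ee]) (simp add: algebra_simps)
    also have "norm (ee (- 2 * b) * ee (2 * of_int k * (a - \<tau>))) / \<delta>' =
                inverse \<delta>' * norm (ee (- 2 * b)) * norm (ee (2 * of_int k * (a - \<tau>)))"
      by (simp add: norm_mult field_simps)
    also have "\<dots> \<le> C * exp (- (\<epsilon> * \<bar>of_int k\<bar>))"
    proof (intro mult_mono)
      have "\<epsilon> * (- of_int k) \<le> 2 * pi * (Im \<tau> - Im a) * (- of_int k)"
        using False by (intro mult_right_mono) (auto simp: \<epsilon>_def)
      then show "norm (ee (2 * of_int k * (a - \<tau>))) \<le> exp (- (\<epsilon> * \<bar>of_int k\<bar>))"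
        using False by (simp add: norm_ee algebra_simps)
    qed (use C0 in \<open>auto simp: C_def\<close>)
    finally show ?thesis by (simp add: X_def)
  qed
  show ?thesis
    by (rule summable_on_comparison_test[OF summable_on_cmult_right[OF summable_exp_neg_abs_int[OF \<epsilon>], of C]])
      (use bound in auto)
qed

section \<open>The Appell series and Kronecker's formula\<close>

text \<open>The reflection \<open>k \<mapsto> 2N + 1 - k\<close> changes the sign of every term: these are the zeros of the theta
function at the points of the period lattice.\<close>

lemma theta_zero:
  fixes N :: int
  shows "(\<Sum>\<^sub>\<infinity>k::int. ee (of_int k + (of_int k ^ 2 - of_int k - 2 * of_int N * of_int k) * \<tau>)) = 0" (is "infsum ?f _ = 0")
proof -
  have "infsum ?f UNIV = (\<Sum>\<^sub>\<infinity>k. - ?f k)"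
  proof (rule infsum_reindex_bij_witness[of _ "\<lambda>k. 2 * N + 1 - k" "\<lambda>k. 2 * N + 1 - k"])
    fix k :: int
    have "of_int (2 * N + 1 - k) + (of_int (2 * N + 1 - k) ^ 2 - of_int (2 * N + 1 - k) - 2 * of_int N * of_int (2 * N + 1 - k)) * \<tau>
       = (of_int k + (of_int k ^ 2 - of_int k - 2 * of_int N * of_int k) * \<tau>) + 1 + 2 * of_int (N - k)"
      by (simp add: algebra_simps power2_eq_square)
    then show "- ?f (2 * N + 1 - k) = ?f k" by (simp only: ee_add ee_two_of_int ee_1) simp
  qed auto
  then show ?thesis by (simp add: infsum_uminus)
qed

text \<open>The series \<open>\<Sum>\<^sub>k (-1)\<^sup>k q\<^bsup>k(k-1)/2\<^esup> / (1 - v q\<^sup>k)\<close> with \<open>v = e\<^bsup>2\<pi>ib\<^esup>\<close>.\<close>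

definition appell :: "complex \<Rightarrow> complex \<Rightarrow> complex" where
  "appell \<tau> b = (\<Sum>\<^sub>\<infinity>k::int. ee (of_int k + (of_int k ^ 2 - of_int k) * \<tau>) / (1 - ee (2 * (b + of_int k * \<tau>))))"

text \<open>With \<open>X = v q\<^sup>k\<close>, the partial fraction \<open>1/(X(1-X)) = 1/X + 1/(1-X)\<close> shows that raising \<open>N\<close> by one
multiplies the series by \<open>v\<close>, up to a theta series that vanishes by \<open>theta_zero\<close>.\<close>

lemma appell_shift:
  fixes N :: int
  assumes \<tau>: "Im \<tau> > 0" and b: "b \<notin> period_lattice \<tau>"
  shows "(\<Sum>\<^sub>\<infinity>k::int. ee (of_int k + (of_int k ^ 2 - of_int k - 2 * of_int N * of_int k) * \<tau>) / (1 - ee (2 * (b + of_int k * \<tau>))))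
          = ee (2 * of_int N * b) * appell \<tau> b"
proof -
  define t where "t N k = ee (of_int k + (of_int k ^ 2 - of_int k - 2 * of_int N * of_int k) * \<tau>)" for N k :: int
  define X where "X k = ee (2 * (b + of_int k * \<tau>))" for k :: int
  have t: "t N k = ee (\<tau> * of_int k ^ 2 + (1 - \<tau> - 2 * of_int N * \<tau>) * of_int k + 0)" for N k
    unfolding t_def by (rule arg_cong[where f = ee]) (simp add: algebra_simps)
  have sum1: "t N summable_on UNIV" for N
    unfolding t[abs_def] by (rule abs_summable_summable[OF ee_quadratic_summable[OF \<tau>]])
  have sum2: "(\<lambda>k. t N k / (1 - X k)) summable_on UNIV" for N
    unfolding t X_def by (rule abs_summable_summable[OF lerch_summable[OF \<tau> \<tau> b]])
  have step: "(\<Sum>\<^sub>\<infinity>k. t (N + 1) k / (1 - X k)) = ee (2 * b) * (\<Sum>\<^sub>\<infinity>k. t N k / (1 - X k))" for N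
  proof -
    have "t (N + 1) k / (1 - X k) = t (N + 1) k + ee (2 * b) * (t N k / (1 - X k))" for k
    proof -
      have "X k * t (N + 1) k = ee (2 * b) * t N k"
        unfolding X_def t_def ee_add[symmetric] by (rule arg_cong[where f = ee]) (simp add: algebra_simps)
      moreover have "1 - X k \<noteq> 0" unfolding X_def by (rule not_in_lattice_denom[OF b])
      ultimately show ?thesis by (simp add: field_simps)
    qed
    then have "(\<Sum>\<^sub>\<infinity>k. t (N + 1) k / (1 - X k)) = (\<Sum>\<^sub>\<infinity>k. t (N + 1) k + ee (2 * b) * (t N k / (1 - X k)))" by simp
    also have "\<dots> = (\<Sum>\<^sub>\<infinity>k. t (N + 1) k) + ee (2 * b) * (\<Sum>\<^sub>\<infinity>k. t N k / (1 - X k))"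
      by (subst infsum_add[OF sum1 summable_on_cmult_right[OF sum2]]) (simp only: infsum_cmult_right')
    also have "(\<Sum>\<^sub>\<infinity>k. t (N + 1) k) = 0"
      unfolding t_def by (rule theta_zero)
    finally show ?thesis by simp
  qed
  have "(\<Sum>\<^sub>\<infinity>k. t N k / (1 - X k)) = ee (2 * of_int N * b) * appell \<tau> b"
  proof (induction N rule: int_induct[of _ 0])
    case base
    show ?case by (simp add: appell_def t_def X_def)
  next
    case (step1 i)
    then show ?case using step[of i] by (simp add: ring_distribs ee_add)
  next
    case (step2 i)
    have "ee (2 * b) * (\<Sum>\<^sub>\<infinity>k. t (i - 1) k / (1 - X k)) = ee (2 * b) * (ee (2 * of_int (i - 1) * b) * appell \<tau> b)"
      using step[of "i - 1"] step2 by (simp add: ring_distribs ee_diff)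
    then show ?case by simp
  qed
  then show ?thesis by (simp add: t_def X_def)
qed

lemma vartheta11_series:
  "vartheta 1 1 \<tau> z = (\<Sum>\<^sub>\<infinity>n::int. ee (\<tau> * of_int n ^ 2 + (\<tau> + 2 * z + 1) * of_int n + (\<tau> / 4 + z + 1 / 2)))"
  unfolding vartheta_def ee_def by (intro infsum_cong arg_cong[where f = exp]) (simp add: field_simps power2_eq_square)

lemma vartheta11_odd: "vartheta 1 1 \<tau> (- z) = - vartheta 1 1 \<tau> z"
proof -
  define f where "f z n = ee (\<tau> * of_int n ^ 2 + (\<tau> + 2 * z + 1) * of_int n + (\<tau> / 4 + z + 1 / 2))" for z and n :: int
  have "infsum (f (- z)) UNIV = (\<Sum>\<^sub>\<infinity>n. - f z n)"
  proof (rule infsum_reindex_bij_witness[of _ "\<lambda>n. - 1 - n" "\<lambda>n. - 1 - n"])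
    fix n :: int
    have "\<tau> * of_int n ^ 2 + (\<tau> + 2 * (- z) + 1) * of_int n + (\<tau> / 4 + (- z) + 1 / 2) =
      (\<tau> * of_int (- 1 - n) ^ 2 + (\<tau> + 2 * z + 1) * of_int (- 1 - n) + (\<tau> / 4 + z + 1 / 2)) + 1 + 2 * of_int n"
      by (simp add: algebra_simps power2_eq_square)
    then show "- f z (- 1 - n) = f (- z) n" unfolding f_def by (simp only: ee_add ee_two_of_int ee_1) simp
  qed auto
  moreover have "vartheta 1 1 \<tau> z = infsum (f z) UNIV" for z
    unfolding vartheta11_series f_def[abs_def] ..
  ultimately show ?thesis by (simp only: infsum_uminus)
qed

text \<open>The coefficient of \<open>u\<^bsup>N+1/2\<^esup>\<close> in \<open>\<vartheta>(a) \<Sum>\<^sub>k u\<^sup>k / (1 - v q\<^sup>k)\<close> is one of the series of \<open>appell_shift\<close>, hence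
\<open>v\<^sup>N\<close> times a coefficient of \<open>\<vartheta>\<close>; the factors \<open>v\<^sup>N\<close> move the argument of \<open>\<vartheta>\<close> from \<open>a\<close> to \<open>a + b\<close>.\<close>

lemma theta_times_kronecker:
  assumes a: "0 < Im a" "Im a < Im \<tau>" and b: "b \<notin> period_lattice \<tau>"
  shows "vartheta 1 1 \<tau> a * (\<Sum>\<^sub>\<infinity>k::int. ee (2 * of_int k * a) / (1 - ee (2 * (b + of_int k * \<tau>))))
          = vartheta 1 1 \<tau> (a + b) * ee (- b) * appell \<tau> b"
proof -
  have \<tau>: "Im \<tau> > 0" using a by simp
  define T where "T z n = ee (\<tau> * of_int n ^ 2 + (\<tau> + 2 * z + 1) * of_int n + (\<tau> / 4 + z + 1 / 2))" for z and n :: int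
  define X where "X k = ee (2 * (b + of_int k * \<tau>))" for k :: int
  define K where "K = (\<lambda>k::int. ee (2 * of_int k * a) / (1 - X k))"
  define t where "t N k = ee (of_int k + (of_int k ^ 2 - of_int k - 2 * of_int N * of_int k) * \<tau>)" for N k :: int
  have "((\<lambda>(n, k). T a n * K k) has_sum infsum (T a) UNIV * infsum K UNIV) UNIV"
    unfolding T_def[abs_def] K_def X_def by (intro has_sum_product ee_quadratic_summable \<tau> kronecker_summable a b)
  also have "?this \<longleftrightarrow> ((\<lambda>(N, k). T a N * (t N k / (1 - X k))) has_sum infsum (T a) UNIV * infsum K UNIV) (UNIV \<times> UNIV)"
  proof (rule has_sum_reindex_bij_witness[of _ "\<lambda>(N, k). (N - k, k)" "\<lambda>(n, k). (n + k, k)"]; clarsimp)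
    fix n k :: int
    have "\<tau> * of_int (n + k) ^ 2 + (\<tau> + 2 * a + 1) * of_int (n + k) + (\<tau> / 4 + a + 1 / 2)
         + (of_int k + (of_int k ^ 2 - of_int k - 2 * of_int (n + k) * of_int k) * \<tau>)
        = \<tau> * of_int n ^ 2 + (\<tau> + 2 * a + 1) * of_int n + (\<tau> / 4 + a + 1 / 2) + 2 * of_int k * a + 2 * of_int k"
      by (simp add: algebra_simps power2_eq_square)
    then have "T a (n + k) * t (n + k) k = T a n * ee (2 * of_int k * a)"
      unfolding T_def t_def ee_add[symmetric] by (simp only: ee_add[of _ "2 * of_int k"] ee_two_of_int mult_1_right)
    then show "T a (n + k) * t (n + k) k / (1 - X k) = T a n * K k" by (simp add: K_def)
  qed
  finally have sum: "((\<lambda>(N, k). T a N * (t N k / (1 - X k))) has_sum infsum (T a) UNIV * infsum K UNIV) (UNIV \<times> UNIV)" .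
  have "((\<lambda>k. T a N * (t N k / (1 - X k))) has_sum T a N * (ee (2 * of_int N * b) * appell \<tau> b)) UNIV" for N
  proof -
    have "t N k = ee (\<tau> * of_int k ^ 2 + (1 - \<tau> - 2 * of_int N * \<tau>) * of_int k + 0)" for k
      unfolding t_def by (rule arg_cong[where f = ee]) (simp add: algebra_simps)
    then have "(\<lambda>k. t N k / (1 - X k)) summable_on UNIV"
      unfolding X_def by (simp only:) (rule abs_summable_summable[OF lerch_summable[OF \<tau> \<tau> b]])
    from has_sum_cmult_right[OF has_sum_infsum[OF this], of "T a N"]
    show ?thesis using appell_shift[OF \<tau> b, of N] by (simp add: t_def X_def)
  qed
  then have "((\<lambda>N. T a N * (ee (2 * of_int N * b) * appell \<tau> b)) has_sum infsum (T a) UNIV * infsum K UNIV) UNIV"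
    by (intro has_sum_SigmaD[OF sum]) simp
  also have "(\<lambda>N. T a N * (ee (2 * of_int N * b) * appell \<tau> b)) = (\<lambda>N. T (a + b) N * (ee (- b) * appell \<tau> b))"
  proof
    fix N
    have "T a N * ee (2 * of_int N * b) = T (a + b) N * ee (- b)"
      unfolding T_def ee_add[symmetric] by (rule arg_cong[where f = ee]) (simp add: algebra_simps)
    then show "T a N * (ee (2 * of_int N * b) * appell \<tau> b) = T (a + b) N * (ee (- b) * appell \<tau> b)"
      by (simp only: mult.assoc [symmetric])
  qed
  finally have "infsum (T a) UNIV * infsum K UNIV = (\<Sum>\<^sub>\<infinity>N. T (a + b) N * (ee (- b) * appell \<tau> b))"
    by (simp add: has_sum_iff)
  moreover have "vartheta 1 1 \<tau> z = infsum (T z) UNIV" for z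
    unfolding vartheta11_series T_def[abs_def] ..
  ultimately show ?thesis
    by (simp only: infsum_cmult_left' K_def X_def mult.assoc)
qed

text \<open>For fixed \<open>N\<close> the coefficient \<open>dsgn (N - l) l\<close> selects the finite range \<open>0..N\<close>, or, with a minus sign,
\<open>N+1..-1\<close> for negative \<open>N\<close>.  The sum over it is the function \<open>F\<close> with \<open>F(-1) = 0\<close> and increments
\<open>f\<close>, which treats both signs of \<open>N\<close> at once.\<close>

lemma has_sum_dsgn_antidiagonal:
  assumes F0: "F (-1) = 0" and F: "\<And>N. F (N + 1) = F N + f (N + 1)"
  shows "((\<lambda>l. dsgn (N - l) l * f l) has_sum F N) UNIV"
proof (induction N rule: int_induct[of _ "-1"])
  case base
  have "dsgn (- 1 - l) l * f l = 0" for l by (auto simp: dsgn_def)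
  then show ?case by (simp only: F0 has_sum_0_simp)
next
  have single: "((\<lambda>l. if l = N then f l else 0) has_sum f N) UNIV" for N
    by (rule has_sum_finite_neutralI[of "{N}"]) auto
  have diff: "dsgn (N + 1 - l) l * f l = dsgn (N - l) l * f l + (if l = N + 1 then f l else 0)" for N l
    by (auto simp: dsgn_def)
  {
    case (step1 i)
    from has_sum_add[OF step1(2) single[of "i + 1"]] show ?case
      by (simp only: F diff)
  next
    case (step2 i)
    from has_sum_add[OF step2(2) has_sum_uminusI[OF single[of i]]]
    show ?case using F[of "i - 1"] diff[of "i - 1"] by simp
  }
qed

lemma dedekind_eta_eq: "dedekind_eta \<tau> = ee (\<tau> / 12) * (\<Prod>n. 1 - ee (2 * \<tau>) ^ Suc n)"
proof -
  have "qpow \<tau> (real (Suc n)) = ee (2 * \<tau>) ^ Suc n" for n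
    unfolding qpow_ee ee_of_nat_mult[symmetric] by (simp add: mult_ac)
  then show ?thesis unfolding dedekind_eta_def by (simp only: qpow_ee) simp
qed

text \<open>In the strip the product is a triple series.  Collected by the exponent \<open>p\<close> of \<open>v\<close> and by \<open>N = k + l\<close>,
it has an inner finite geometric sum with ratio \<open>q\<^bsup>-p\<^esup>\<close>.  For \<open>p \<noteq> 0\<close> the geometric sum formula leaves
two vanishing theta series.  For \<open>p = 0\<close> the inner sum is \<open>N + 1\<close>, and what remains is Jacobi's series.
So the product does not depend on \<open>b\<close> apart from the factor \<open>e\<^bsup>\<pi>ib\<^esup>\<close>.\<close>

lemma theta_times_appell_strip:
  assumes b: "0 < Im b" "Im b < Im \<tau>"
  shows "vartheta 1 1 \<tau> b * appell \<tau> b = - \<i> * ee b * dedekind_eta \<tau> ^ 3"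
proof -
  have \<tau>: "Im \<tau> > 0" using b by simp
  define T where "T n = ee (\<tau> * of_int n ^ 2 + (\<tau> + 2 * b + 1) * of_int n + (\<tau> / 4 + b + 1 / 2))" for n :: int
  define c where "c k = ee (\<tau> * of_int k ^ 2 + (1 - \<tau>) * of_int k + 0)" for k :: int
  define h where "h = (\<lambda>(k, l). c k * (dsgn k l * ee (of_int l * (2 * (b + of_int k * \<tau>)))))"
  have app: "appell \<tau> b = (\<Sum>\<^sub>\<infinity>k. c k / (1 - ee (2 * (b + of_int k * \<tau>))))"
    unfolding appell_def c_def by (simp add: algebra_simps)
  have h1: "(\<lambda>x. norm (h x)) summable_on UNIV" and h2: "(h has_sum appell \<tau> b) UNIV"
    using lerch_expansion[OF b \<tau>, of "1 - \<tau>" 0] unfolding app h_def c_def by (simp_all add: case_prod_unfold)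
  have T1: "(\<lambda>n. norm (T n)) summable_on UNIV"
    unfolding T_def by (rule ee_quadratic_summable[OF \<tau>])
  define S where "S = vartheta 1 1 \<tau> b * appell \<tau> b"
  have S: "((\<lambda>(n, x). T n * h x) has_sum S) UNIV"
    using has_sum_product(2)[OF T1 h1] h2 unfolding S_def vartheta11_series T_def[symmetric] by (simp add: has_sum_iff)
  define J where "J N = ee (of_int N + (of_int N ^ 2 - of_int N) * \<tau>)" for N :: int
  define D where "D p = ee (of_int p + (of_int p ^ 2 + of_int p) * \<tau> + 2 * of_int p * b + (\<tau> / 4 + b + 1 / 2))" for p :: int
  define Y where "Y p l = ee (of_int l * (- 2 * of_int p * \<tau>))" for p l :: int
  define W where "W = (\<lambda>(p, N, l). D p * (J N * (dsgn (N - l) l * Y p l)))"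
  have "((\<lambda>(n, x). T n * h x) has_sum S) UNIV \<longleftrightarrow> (W has_sum S) (UNIV \<times> (UNIV \<times> UNIV))"
  proof (rule has_sum_reindex_bij_witness[of _ "\<lambda>(p, N, l). (p - l, N - l, l)" "\<lambda>(n, k, l). (n + l, k + l, l)"]; clarsimp)
    fix n k l :: int
    have "(of_int (n + l) + (of_int (n + l) ^ 2 + of_int (n + l)) * \<tau> + 2 * of_int (n + l) * b + (\<tau> / 4 + b + 1 / 2))
       + ((of_int (k + l) + (of_int (k + l) ^ 2 - of_int (k + l)) * \<tau>) + (of_int l * (- 2 * of_int (n + l) * \<tau>))) =
       (\<tau> * of_int n ^ 2 + (\<tau> + 2 * b + 1) * of_int n + (\<tau> / 4 + b + 1 / 2)) +
       ((\<tau> * of_int k ^ 2 + (1 - \<tau>) * of_int k + 0) + of_int l * (2 * (b + of_int k * \<tau>))) + 2 * of_int l"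
      by (simp add: algebra_simps power2_eq_square)
    then have "D (n + l) * (J (k + l) * Y (n + l) l) = T n * (c k * ee (of_int l * (2 * (b + of_int k * \<tau>))))"
      unfolding D_def J_def Y_def T_def c_def ee_add[symmetric] by (simp only: ee_add[of _ "2 * of_int l"] ee_two_of_int mult_1_right)
    then show "W (n + l, k + l, l) = T n * h (k, l)"
      by (simp add: W_def h_def mult_ac)
  qed
  with S have W: "(W has_sum S) (UNIV \<times> (UNIV \<times> UNIV))" by simp
  \<comment> \<open>the inner finite geometric sum over \<open>l\<close>\<close>
  define G where "G p N = (if p = 0 then of_int (N + 1) else (1 - Y p (N + 1)) / (1 - Y p 1))" for p N :: int
  have Y1: "Y p 1 \<noteq> 1" if "p \<noteq> 0" for p
  proof
    assume "Y p 1 = 1"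
    then have "norm (Y p 1) = 1" by simp
    then show False using that \<tau> by (simp add: Y_def norm_ee)
  qed
  have inner: "((\<lambda>l. dsgn (N - l) l * Y p l) has_sum G p N) UNIV" for p N
  proof (rule has_sum_dsgn_antidiagonal)
    show "G p (- 1) = 0" by (simp add: G_def Y_def)
    fix N
    have "Y p (N + 1 + 1) = Y p (N + 1) * Y p 1"
      unfolding Y_def ee_add[symmetric] by (rule arg_cong[where f = ee]) (simp add: algebra_simps)
    then show "G p (N + 1) = G p N + Y p (N + 1)"
      using Y1[of p] by (simp add: G_def field_simps) (simp add: Y_def)
  qed
  have sumJ: "(\<lambda>N. J N * ee (B * of_int N)) summable_on UNIV" for B
  proof -
    have "J N * ee (B * of_int N) = ee (\<tau> * of_int N ^ 2 + (1 - \<tau> + B) * of_int N + 0)" for N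
      unfolding J_def ee_add[symmetric] by (rule arg_cong[where f = ee]) (simp add: algebra_simps)
    then show ?thesis by (simp only:) (rule abs_summable_summable[OF ee_quadratic_summable[OF \<tau>]])
  qed
  have J0: "(\<Sum>\<^sub>\<infinity>N. J N) = 0"
    using theta_zero[of 0 \<tau>] by (simp add: J_def)
  define P where "P = (\<Prod>n. 1 - ee (2 * \<tau>) ^ Suc n)"
  have mid: "((\<lambda>(N, l). J N * (dsgn (N - l) l * Y p l)) has_sum (if p = 0 then - (P ^ 3) else 0)) UNIV" for p
  proof -
    have "(\<lambda>(N, l). W (p, N, l)) summable_on (UNIV \<times> UNIV)"
    proof -
      have "W summable_on (UNIV \<times> (UNIV \<times> UNIV))" using W by (auto simp: has_sum_iff)
      from summable_on_SigmaD1[of "\<lambda>p x. W (p, x)" UNIV "\<lambda>_. UNIV \<times> UNIV" p] this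
      show ?thesis by (simp add: case_prod_unfold)
    qed
    then have "(\<lambda>x. inverse (D p) * W (p, x)) summable_on (UNIV \<times> UNIV)"
      by (intro summable_on_cmult_right) (simp add: case_prod_unfold)
    also have "(\<lambda>x. inverse (D p) * W (p, x)) = (\<lambda>(N, l). J N * (dsgn (N - l) l * Y p l))"
      by (auto simp: fun_eq_iff W_def D_def)
    finally have su: "(\<lambda>(N, l). J N * (dsgn (N - l) l * Y p l)) summable_on (UNIV \<times> UNIV)" .
    have in1: "((\<lambda>l. J N * (dsgn (N - l) l * Y p l)) has_sum J N * G p N) UNIV" for N
      by (intro has_sum_cmult_right inner)
    have su1: "((\<lambda>N. J N * G p N) has_sum (\<Sum>\<^sub>\<infinity>x. case x of (N, l) \<Rightarrow> J N * (dsgn (N - l) l * Y p l))) UNIV"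
      using has_sum_SigmaD[OF has_sum_infsum[OF su], of "\<lambda>N. J N * G p N"] in1 by simp
    then have su2: "(\<lambda>N. J N * G p N) summable_on UNIV" by (auto simp: has_sum_iff)
    have "(\<Sum>\<^sub>\<infinity>N. J N * G p N) = (if p = 0 then - (P ^ 3) else 0)"
    proof (cases "p = 0")
      case True
      have "(\<lambda>N. J N * G p N + (- 1) * J N) summable_on UNIV"
        by (intro summable_on_add su2 summable_on_cmult_right) (use sumJ[of 0] in simp)
      then have "(\<lambda>N. of_int N * J N) summable_on UNIV"
        by (simp add: True G_def algebra_simps)
      then have "(\<Sum>\<^sub>\<infinity>N. of_int N * J N + J N) = (\<Sum>\<^sub>\<infinity>N. of_int N * J N) + (\<Sum>\<^sub>\<infinity>N. J N)"
        by (intro infsum_add) (use sumJ[of 0] in auto)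
      also have "(\<Sum>\<^sub>\<infinity>N. of_int N * J N) = - (P ^ 3)"
        using jacobi_cube[OF \<tau>] by (simp add: J_def P_def)
      finally show ?thesis using J0 by (simp add: True G_def algebra_simps)
    next
      case False
      have "(\<Sum>\<^sub>\<infinity>N. J N * Y p N) = 0"
      proof -
        have "J N * Y p N = ee (of_int N + (of_int N ^ 2 - of_int N - 2 * of_int p * of_int N) * \<tau>)" for N
          unfolding J_def Y_def ee_add[symmetric] by (rule arg_cong[where f = ee]) (simp add: algebra_simps)
        then show ?thesis using theta_zero[of p \<tau>] by simp
      qed
      moreover have "(\<lambda>N. J N * Y p N) summable_on UNIV"
        using sumJ[of "- 2 * of_int p * \<tau>"] by (simp add: Y_def mult_ac)
      moreover have "J N * G p N = inverse (1 - Y p 1) * J N + (- Y p 1 * inverse (1 - Y p 1)) * (J N * Y p N)" for N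
      proof -
        have "Y p (N + 1) = Y p N * Y p 1" 
          unfolding Y_def ee_add[symmetric] by (rule arg_cong[where f = ee]) (simp add: algebra_simps)
        then show ?thesis using False Y1[OF False] by (simp add: G_def divide_inverse algebra_simps)
      qed
      moreover have "J summable_on UNIV" using sumJ[of 0] by simp
      ultimately have "(\<Sum>\<^sub>\<infinity>N. J N * G p N) = inverse (1 - Y p 1) * infsum J UNIV
          + (- Y p 1 * inverse (1 - Y p 1)) * (\<Sum>\<^sub>\<infinity>N. J N * Y p N)"
        by (simp only: infsum_add summable_on_cmult_right infsum_cmult_right')
      then show ?thesis
        using J0 False \<open>(\<Sum>\<^sub>\<infinity>N. J N * Y p N) = 0\<close> by simp
    qed
    with su1 have "(\<Sum>\<^sub>\<infinity>x. case x of (N, l) \<Rightarrow> J N * (dsgn (N - l) l * Y p l)) = (if p = 0 then - (P ^ 3) else 0)"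
      by (simp add: has_sum_iff)
    with su show ?thesis by (simp add: has_sum_iff)
  qed
  have "((\<lambda>p. D p * (if p = 0 then - (P ^ 3) else 0)) has_sum S) UNIV"
  proof (rule has_sum_SigmaD[OF W])
    fix p :: int
    show "((\<lambda>x. W (p, x)) has_sum D p * (if p = 0 then - (P ^ 3) else 0)) (UNIV \<times> UNIV)"
      using has_sum_cmult_right[OF mid[of p], of "D p"] by (simp add: W_def case_prod_unfold)
  qed
  moreover have "((\<lambda>p. D p * (if p = 0 then - (P ^ 3) else 0)) has_sum D 0 * (- (P ^ 3))) UNIV"
    by (rule has_sum_finite_neutralI[of "{0}"]) auto
  ultimately have "S = D 0 * (- (P ^ 3))" by (rule has_sum_unique)
  also have "D 0 = \<i> * ee b * ee (\<tau> / 4)"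
  proof -
    have "ee (1 / 2) = \<i>"
      by (simp add: ee_def exp_eq_polar complex_eq_iff cis.ctr Re_exp Im_exp)
    then show ?thesis by (simp add: D_def ee_add)
  qed
  also have "ee (\<tau> / 4) = ee (\<tau> / 12) ^ 3"
    by (simp flip: ee_of_nat_mult)
  finally show ?thesis
    unfolding S_def dedekind_eta_eq P_def[symmetric] by (simp add: power_mult_distrib)
qed

lemma holomorphic_vartheta11 [holomorphic_intros]:
  assumes "open U" "f holomorphic_on U" "Im \<tau> > 0"
  shows "(\<lambda>t. vartheta 1 1 \<tau> (f t)) holomorphic_on U"
  unfolding vartheta11_series
  by (intro holomorphic_gauss_series) (use assms in \<open>auto intro!: holomorphic_intros\<close>)

lemma connected_minus_lattice: "connected (- period_lattice \<tau>)"
  using connected_open_diff_countable[of "UNIV :: complex set" "period_lattice \<tau>"] connected_UNIV[where 'a = complex]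
  by (simp add: countable_period_lattice Compl_eq_Diff_UNIV)

text \<open>Both sides are holomorphic in \<open>b\<close> outside the lattice, whose complement is connected.\<close>

lemma theta_times_appell:
  assumes \<tau>: "Im \<tau> > 0" and b: "b \<notin> period_lattice \<tau>"
  shows "vartheta 1 1 \<tau> b * appell \<tau> b = - \<i> * ee b * dedekind_eta \<tau> ^ 3"
proof (rule analytic_continuation_open[where f = "\<lambda>b. vartheta 1 1 \<tau> b * appell \<tau> b"
      and g = "\<lambda>b. - \<i> * ee b * dedekind_eta \<tau> ^ 3" and s = "{z. 0 < Im z} \<inter> {z. Im z < Im \<tau>}" and s' = "- period_lattice \<tau>"])
  show "open ({z. 0 < Im z} \<inter> {z. Im z < Im \<tau>})"
    by (intro open_Int open_halfspace_Im_gt open_halfspace_Im_lt)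
  have "Complex 0 (Im \<tau> / 2) \<in> {z. 0 < Im z} \<inter> {z. Im z < Im \<tau>}" using \<tau> by simp
  then show "{z. 0 < Im z} \<inter> {z. Im z < Im \<tau>} \<noteq> {}" by blast
  show op: "open (- period_lattice \<tau>)"
    using closed_period_lattice[OF \<tau>] by (simp add: open_Compl)
  have "(\<lambda>b. \<Sum>\<^sub>\<infinity>k::int. ee (\<tau> * of_int k ^ 2 + (1 - \<tau>) * of_int k + 0) / (1 - ee (2 * (b + of_int k * \<tau>))))
          holomorphic_on - period_lattice \<tau>"
    by (rule holomorphic_lerch_series[OF op]) (use \<tau> in \<open>auto intro!: holomorphic_intros\<close>)
  also have "(\<lambda>b. \<Sum>\<^sub>\<infinity>k::int. ee (\<tau> * of_int k ^ 2 + (1 - \<tau>) * of_int k + 0) / (1 - ee (2 * (b + of_int k * \<tau>)))) = appell \<tau>"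
    unfolding appell_def by (intro ext infsum_cong arg_cong2[where f = "(/)"] arg_cong[where f = ee]) (simp_all add: algebra_simps)
  finally show "(\<lambda>b. vartheta 1 1 \<tau> b * appell \<tau> b) holomorphic_on - period_lattice \<tau>"
    by (intro holomorphic_on_mult holomorphic_vartheta11 op \<tau> holomorphic_on_ident)
  show "(\<lambda>b. - \<i> * ee b * dedekind_eta \<tau> ^ 3) holomorphic_on - period_lattice \<tau>"
    by (intro holomorphic_intros)
qed (use b strip_not_in_lattice theta_times_appell_strip connected_minus_lattice in auto)

lemma dedekind_eta_nonzero:
  assumes "Im \<tau> > 0"
  shows "dedekind_eta \<tau> \<noteq> 0"
proof -
  have "norm (ee (2 * \<tau>)) < 1" using assms by (simp add: norm_ee)
  from euler_product(2)[OF this] show ?thesis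
    by (simp add: dedekind_eta_eq del: power_Suc)
qed

text \<open>The product with the Appell series is \<open>\<eta>\<^sup>3\<close> up to an exponential factor, and \<open>\<eta>\<close> has no zeros.\<close>

lemma vartheta11_nonzero:
  assumes "Im \<tau> > 0" "b \<notin> period_lattice \<tau>"
  shows "vartheta 1 1 \<tau> b \<noteq> 0"
  using theta_times_appell[OF assms] dedekind_eta_nonzero[OF assms(1)] by auto

text \<open>Kronecker's formula with \<open>b = -c\<close>, the form in which the theta quotients of the theorem appear.\<close>

lemma kronecker_theta_quotient:
  assumes a: "0 < Im a" "Im a < Im \<tau>" and c: "c \<notin> period_lattice \<tau>"
  shows "(\<Sum>\<^sub>\<infinity>k::int. ee (2 * of_int k * a) / (1 - ee (2 * (- c + of_int k * \<tau>)))) =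
          \<i> * (dedekind_eta \<tau> ^ 3 * vartheta 1 1 \<tau> (a - c) / (vartheta 1 1 \<tau> a * vartheta 1 1 \<tau> c))" (is "?K = _")
proof -
  have \<tau>: "Im \<tau> > 0" using a by simp
  have c': "- c \<notin> period_lattice \<tau>" using c by (simp add: period_lattice_uminus)
  have nz: "vartheta 1 1 \<tau> a \<noteq> 0" "vartheta 1 1 \<tau> c \<noteq> 0"
    by (intro vartheta11_nonzero \<tau> strip_not_in_lattice a c)+
  have "vartheta 1 1 \<tau> a * ?K = vartheta 1 1 \<tau> (a - c) * ee c * appell \<tau> (- c)"
    using theta_times_kronecker[OF a c'] by simp
  then have "(vartheta 1 1 \<tau> a * vartheta 1 1 \<tau> c) * ?K = - (vartheta 1 1 \<tau> (a - c) * ee c * (vartheta 1 1 \<tau> (- c) * appell \<tau> (- c)))"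
    unfolding vartheta11_odd by (simp only: mult_ac) (simp add: mult_ac)
  also have "\<dots> = \<i> * dedekind_eta \<tau> ^ 3 * vartheta 1 1 \<tau> (a - c)"
    unfolding theta_times_appell[OF \<tau> c'] by (simp add: ee_minus)
  finally show ?thesis using nz by (simp add: field_simps)
qed

section \<open>Laurent expansion of the half identity\<close>

lemma theta_series:
  assumes "m > 0"
  shows "theta k m \<tau> z = (\<Sum>\<^sub>\<infinity>j::int. ee ((2 * of_real m * \<tau>) * of_int j ^ 2 + (2 * of_real k * \<tau> + 2 * of_real m * z) * of_int j
            + (of_real k * z + of_real (k ^ 2 / (2 * m)) * \<tau>)))"
  unfolding theta_def qpow_ee unfolding ee_def exp_add[symmetric]
  by (intro infsum_cong arg_cong[where f = exp]) (use assms in \<open>simp add: field_simps power2_eq_square\<close>)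

lemma theta_uminus: "theta k m \<tau> (- z) = theta (- k) m \<tau> z"
  unfolding theta_def
proof (rule infsum_reindex_bij_witness[of _ uminus uminus])
  fix j :: int
  have 1: "real_of_int (- j) + - k / (2 * m) = - (real_of_int j + k / (2 * m))" by simp
  show "exp (2 * of_real pi * \<i> * of_real m * of_real (of_int (- j) + - k / (2 * m)) * z) * qpow \<tau> (m * (of_int (- j) + - k / (2 * m)) ^ 2)
      = exp (2 * of_real pi * \<i> * of_real m * of_real (of_int j + k / (2 * m)) * - z) * qpow \<tau> (m * (of_int j + k / (2 * m)) ^ 2)"
    unfolding 1 by (simp only: power2_minus of_real_minus mult_minus_left mult_minus_right)
qed auto

lemma theta_shift:
  fixes i :: int
  assumes "m > 0"
  shows "theta (k + 2 * m * of_int i) m \<tau> z = theta k m \<tau> z"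
  unfolding theta_def
proof (rule infsum_reindex_bij_witness[of _ "\<lambda>j. j - i" "\<lambda>j. j + i"])
  fix j :: int
  have 1: "real_of_int (j + i) + k / (2 * m) = real_of_int j + (k + 2 * m * of_int i) / (2 * m)"
    using assms by (simp add: field_simps)
  show "exp (2 * of_real pi * \<i> * of_real m * of_real (of_int (j + i) + k / (2 * m)) * z) * qpow \<tau> (m * (of_int (j + i) + k / (2 * m)) ^ 2)
      = exp (2 * of_real pi * \<i> * of_real m * of_real (of_int j + (k + 2 * m * of_int i) / (2 * m)) * z)
        * qpow \<tau> (m * (of_int j + (k + 2 * m * of_int i) / (2 * m)) ^ 2)"
    unfolding 1 ..
qed auto

lemma Phi1_series:
  "Phi1 m 0 \<tau> z1 z2 0 = (\<Sum>\<^sub>\<infinity>j::int. ee ((2 * of_real m * \<tau>) * of_int j ^ 2 + (2 * of_real m * (z1 + z2)) * of_int j + 0)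
        / (1 - ee (2 * (z1 + of_int j * \<tau>))))"
  unfolding Phi1_def qpow_ee unfolding ee_def exp_add[symmetric]
  by (simp, intro infsum_cong arg_cong2[where f = "\<lambda>x y. exp x / (1 - exp y)"]) (simp_all add: field_simps power2_eq_square)

lemma Phi2_eq_Phi1: "Phi2 m 0 \<tau> z1 z2 0 = Phi1 m 0 \<tau> (- z2) (- z1) 0"
  unfolding Phi1_def Phi2_def by (simp add: algebra_simps)

text \<open>The common monomials of the three triple series; \<open>A\<close>, \<open>B\<close> and \<open>A + B + Mn\<close> are the exponents of
\<open>e\<^bsup>\<pi>ix\<^esup>\<close>, \<open>e\<^bsup>\<pi>iy\<^esup>\<close> and \<open>e\<^bsup>\<pi>is\<^esup>\<close>.  These exponents determine the power of \<open>q\<close> in all three series.\<close>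

definition theta_mono :: "nat \<Rightarrow> complex \<Rightarrow> complex \<Rightarrow> complex \<Rightarrow> complex \<Rightarrow> int \<Rightarrow> int \<Rightarrow> int \<Rightarrow> complex" where
  "theta_mono M \<tau> s x y A B n = ee (of_int (int M * n ^ 2 + 2 * n * (A + B) - 2 * A * B) * \<tau>
      + of_int A * x + of_int B * y + of_int (A + B + int M * n) * s)"

lemma theta_mono_swap: "theta_mono M \<tau> s x y A B n = theta_mono M \<tau> s y x B A n"
  unfolding theta_mono_def by (rule arg_cong[where f = ee]) (simp add: algebra_simps)

text \<open>If \<open>-B\<close> is the summation index of the theta function, \<open>j\<close> that of \<open>\<Phi>\<^sub>1\<close> and \<open>l\<close> that of the geometric
series, then \<open>A = l - (M+1) B\<close> and \<open>n = j + B\<close>.\<close>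

lemma theta_Phi1_expansion:
  assumes m: "m > 0" "2 * m = real M" and a: "0 < Im ((s + x) / 2)" "Im ((s + x) / 2) < Im \<tau>"
    and w: "2 * of_real (m + 1) * w = of_nat (M + 1) * x - y"
  shows "((\<lambda>((A, B), n). dsgn (n - B) (A + (int M + 1) * B) * theta_mono M \<tau> s x y A B n)
     has_sum theta 0 (m + 1) \<tau> w * Phi1 m 0 \<tau> ((s + x) / 2) ((s - x) / 2) 0) UNIV"
proof -
  have \<tau>: "Im \<tau> > 0" using a by simp
  have M: "2 * of_real m = (of_nat M :: complex)" using m(2) by (metis of_real_mult of_real_numeral of_real_of_nat_eq)
  define T where "T n = ee (2 * of_real (m + 1) * \<tau> * of_int n ^ 2 + (of_nat (M + 1) * x - y) * of_int n + 0)" for n :: int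
  have T: "theta 0 (m + 1) \<tau> w = infsum T UNIV"
    unfolding T_def[abs_def] w[symmetric] by (subst theta_series) (use m in simp_all)
  have T1: "(\<lambda>n. norm (T n)) summable_on UNIV"
    unfolding T_def by (rule ee_quadratic_summable) (use m \<tau> in simp)
  define c where "c j = ee ((2 * of_real m * \<tau>) * of_int j ^ 2 + (2 * of_real m * s) * of_int j + 0)" for j :: int
  define h where "h = (\<lambda>(j, l). c j * (dsgn j l * ee (of_int l * (2 * ((s + x) / 2 + of_int j * \<tau>)))))"
  have h1: "(\<lambda>p. norm (h p)) summable_on UNIV"
    and h2: "(h has_sum (\<Sum>\<^sub>\<infinity>j. c j / (1 - ee (2 * ((s + x) / 2 + of_int j * \<tau>))))) UNIV"
    using lerch_expansion[OF a, of "2 * of_real m * \<tau>" "2 * of_real m * s" 0] m(1) \<tau>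
    unfolding h_def c_def by (simp_all add: case_prod_unfold)
  have "(s + x) / 2 + (s - x) / 2 = s" by (simp add: field_simps)
  then have "Phi1 m 0 \<tau> ((s + x) / 2) ((s - x) / 2) 0 = infsum h UNIV"
    unfolding Phi1_series c_def[symmetric] using h2 by (simp only: infsumI c_def)
  with has_sum_product(2)[OF T1 h1] T
  have "((\<lambda>(n, p). T n * h p) has_sum theta 0 (m + 1) \<tau> w * Phi1 m 0 \<tau> ((s + x) / 2) ((s - x) / 2) 0) UNIV"
    by simp
  also have "?this \<longleftrightarrow> ?thesis"
  proof (rule has_sum_reindex_bij_witness[of _ "\<lambda>((A, B), n). (- B, n - B, A + (int M + 1) * B)"
        "\<lambda>(n, j, l). (((int M + 1) * n + l, - n), j - n)"]; clarsimp)
    fix n j l :: int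
    have "theta_mono M \<tau> s x y ((int M + 1) * n + l) (- n) (j - n) = T n * (c j * ee (of_int l * (2 * ((s + x) / 2 + of_int j * \<tau>))))"
      unfolding theta_mono_def T_def c_def ee_add[symmetric] M of_real_add distrib_left[of 2]
      by (rule arg_cong[where f = ee]) (simp add: algebra_simps power2_eq_square)
    then show "dsgn j l * theta_mono M \<tau> s x y ((int M + 1) * n + l) (- n) (j - n) = T n * h (j, l)"
      by (simp add: h_def)
  qed
  finally show ?thesis .
qed

text \<open>Here \<open>n\<close> is the summation index of the theta function, and the Kronecker series contributes
\<open>A - n\<close> and \<open>B - n\<close> as exponents of \<open>e\<^bsup>2\<pi>ia\<^esup>\<close> and \<open>e\<^bsup>2\<pi>ic\<^esup>\<close>.  As \<open>-c\<close> lies in the strip below the real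
line, the geometric expansion changes its form between \<open>k = 0\<close> and \<open>k = 1\<close>, whence the shift of the
first argument of \<open>dsgn\<close> by one.\<close>

lemma theta_kronecker_expansion:
  assumes m: "m > 0" "2 * m = real M" and a: "0 < Im a" "Im a < Im \<tau>" and c: "0 < Im c" "Im c < Im \<tau>"
    and ac: "a = (s + x) / 2" "c = (s + y) / 2"
    and w: "2 * of_real (m + 1) * w = of_nat (M + 2) * s + x + y"
  shows "((\<lambda>((A, B), n). dsgn (A - n - 1) (n - B) * theta_mono M \<tau> s x y A B n)
     has_sum theta 0 (m + 1) \<tau> w * (\<Sum>\<^sub>\<infinity>k::int. ee (2 * of_int k * a) / (1 - ee (2 * (- c + of_int k * \<tau>))))) UNIV"
proof -
  have \<tau>: "Im \<tau> > 0" using a by simp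
  have M: "2 * of_real m = (of_nat M :: complex)" using m(2) by (metis of_real_mult of_real_numeral of_real_of_nat_eq)
  define T where "T n = ee (2 * of_real (m + 1) * \<tau> * of_int n ^ 2 + (of_nat (M + 2) * s + x + y) * of_int n + 0)" for n :: int
  have T: "theta 0 (m + 1) \<tau> w = infsum T UNIV"
    unfolding T_def[abs_def] w[symmetric] by (subst theta_series) (use m in simp_all)
  have T1: "(\<lambda>n. norm (T n)) summable_on UNIV"
    unfolding T_def by (rule ee_quadratic_summable) (use m \<tau> in simp)
  define \<zeta> where "\<zeta> k = 2 * (- c + of_int k * \<tau>)" for k :: int
  define h where "h = (\<lambda>(k, l). ee (2 * of_int k * a) * (dsgn (k - 1) l * ee (of_int l * \<zeta> k)))"
  have sgn: "if 0 \<le> k - 1 then Im (\<zeta> k) > 0 else Im (\<zeta> k) < 0" for k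
  proof (cases "0 \<le> k - 1")
    case True
    then have "1 * Im \<tau> \<le> of_int k * Im \<tau>" using \<tau> by (intro mult_right_mono) auto
    then have "Im c < of_int k * Im \<tau>" using c by linarith
    then show ?thesis using True by (simp add: \<zeta>_def)
  next
    case False
    then have "of_int k * Im \<tau> \<le> 0" using \<tau> by (simp add: mult_nonpos_nonneg)
    then show ?thesis using False c by (simp add: \<zeta>_def)
  qed
  have summ: "(\<lambda>k. norm (ee (2 * of_int k * a) / (1 - ee (\<i> * Im (\<zeta> k))))) summable_on UNIV"
  proof -
    have "\<i> * Im c \<notin> period_lattice (\<i> * Im \<tau>)" using c by (intro strip_not_in_lattice) auto
    then have "- (\<i> * Im c) \<notin> period_lattice (\<i> * Im \<tau>)" by (simp add: period_lattice_uminus)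
    moreover have "0 < Im a" "Im a < Im (\<i> * Im \<tau>)" using a by auto
    ultimately have "(\<lambda>k::int. norm (ee (2 * of_int k * a) / (1 - ee (2 * (- (\<i> * Im c) + of_int k * (\<i> * Im \<tau>)))))) summable_on UNIV"
      by (intro kronecker_summable)
    moreover have "2 * (- (\<i> * Im c) + of_int k * (\<i> * Im \<tau>)) = \<i> * Im (\<zeta> k)" for k
      by (simp add: \<zeta>_def algebra_simps)
    ultimately show ?thesis by simp
  qed
  have h1: "(\<lambda>p. norm (h p)) summable_on UNIV"
    and h2: "(h has_sum (\<Sum>\<^sub>\<infinity>k. ee (2 * of_int k * a) / (1 - ee (\<zeta> k)))) UNIV"
    using dsgn_expansion[of "\<lambda>k. k - 1" \<zeta> "\<lambda>k. ee (2 * of_int k * a)", OF sgn summ]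
    unfolding h_def by (simp_all add: case_prod_unfold)
  then have "(\<Sum>\<^sub>\<infinity>k. ee (2 * of_int k * a) / (1 - ee (2 * (- c + of_int k * \<tau>)))) = infsum h UNIV"
    unfolding \<zeta>_def by (simp only: infsumI)
  with has_sum_product(2)[OF T1 h1] T
  have "((\<lambda>(n, p). T n * h p) has_sum theta 0 (m + 1) \<tau> w *
      (\<Sum>\<^sub>\<infinity>k. ee (2 * of_int k * a) / (1 - ee (2 * (- c + of_int k * \<tau>))))) UNIV"
    by simp
  also have "?this \<longleftrightarrow> ?thesis"
  proof (rule has_sum_reindex_bij_witness[of _ "\<lambda>((A, B), n). (n, A - n, n - B)"
        "\<lambda>(n, k, l). ((k + n, n - l), n)"]; clarsimp)
    fix n k l :: int
    have "theta_mono M \<tau> s x y (k + n) (n - l) n = T n * (ee (2 * of_int k * a) * ee (of_int l * \<zeta> k))"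
      unfolding theta_mono_def T_def \<zeta>_def ac ee_add[symmetric] of_real_add distrib_left[of 2] M
      by (rule arg_cong[where f = ee]) (simp add: algebra_simps power2_eq_square add_divide_distrib)
    then show "dsgn (k - 1) l * theta_mono M \<tau> s x y (k + n) (n - l) n = T n * h (k, l)"
      by (simp add: h_def)
  qed
  finally show ?thesis .
qed

text \<open>The coefficient of a monomial in the half identity.  It vanishes outside the double sector between
the lines \<open>A + (M+1) B = 0\<close> and \<open>B + (M+1) A = 0\<close>.\<close>

definition half_plane_sgn :: "nat \<Rightarrow> int \<Rightarrow> int \<Rightarrow> complex" where
  "half_plane_sgn M A B = of_bool (0 \<le> A + (int M + 1) * B) - of_bool (0 \<le> B + (int M + 1) * A)"

text \<open>What remains of a monomial when the theta function with index \<open>A + B\<close> is split off from the sum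
over \<open>n\<close>.\<close>

definition lattice_weight :: "nat \<Rightarrow> complex \<Rightarrow> complex \<Rightarrow> complex \<Rightarrow> int \<Rightarrow> int \<Rightarrow> complex" where
  "lattice_weight M \<tau> x y A B = ee (of_int A * x + of_int B * y
      - (2 * of_int A * of_int B + of_int (A + B) ^ 2 / of_nat M) * \<tau>)"

text \<open>The conditions \<open>n \<ge> B\<close> and \<open>n \<ge> A\<close> enter the first two coefficients additively, and the third
coefficient is their difference.\<close>

lemma sgn_cancellation:
  "dsgn (n - B) (A + (int M + 1) * B) - dsgn (n - A) (B + (int M + 1) * A) - dsgn (A - n - 1) (n - B) = half_plane_sgn M A B"
  by (auto simp: dsgn_def half_plane_sgn_def)

text \<open>The three expansions have the same monomials, so they may be subtracted term by term; the
coefficient is then independent of \<open>n\<close>, and the sum over \<open>n\<close> is a theta function of \<open>s\<close>.\<close>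

lemma strip_half_identity:
  assumes m: "m > 0" "2 * m = real M"
    and a: "0 < Im a" "Im a < Im \<tau>" and c: "0 < Im c" "Im c < Im \<tau>"
    and ac: "a = (s + x) / 2" "c = (s + y) / 2"
    and w1: "2 * of_real (m + 1) * w1 = of_nat (M + 1) * x - y"
    and w2: "2 * of_real (m + 1) * w2 = of_nat (M + 1) * y - x"
    and w3: "2 * of_real (m + 1) * w3 = of_nat (M + 2) * s + x + y"
  shows "((\<lambda>(A, B). half_plane_sgn M A B * lattice_weight M \<tau> x y A B * theta (of_int (A + B)) m \<tau> s) has_sum
      theta 0 (m + 1) \<tau> w1 * Phi1 m 0 \<tau> a (s - a) 0 - theta 0 (m + 1) \<tau> w2 * Phi1 m 0 \<tau> c (s - c) 0
      - \<i> * theta 0 (m + 1) \<tau> w3 * (dedekind_eta \<tau> ^ 3 * vartheta 1 1 \<tau> (a - c) / (vartheta 1 1 \<tau> a * vartheta 1 1 \<tau> c))) UNIV"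
    (is "(_ has_sum ?X) _")
proof -
  have \<tau>: "Im \<tau> > 0" using a by simp
  have M: "2 * of_real m = (of_nat M :: complex)" using m(2) by (metis of_real_mult of_real_numeral of_real_of_nat_eq)
  have M0: "M > 0" using m by (metis mult_pos_pos of_nat_0_less_iff zero_less_numeral)
  have a2: "s - a = (s - x) / 2" "s - c = (s - y) / 2" by (simp_all add: ac field_simps)
  have 1: "((\<lambda>((A, B), n). dsgn (n - B) (A + (int M + 1) * B) * theta_mono M \<tau> s x y A B n)
      has_sum theta 0 (m + 1) \<tau> w1 * Phi1 m 0 \<tau> a (s - a) 0) UNIV"
    unfolding a2 unfolding ac by (rule theta_Phi1_expansion[OF m]) (use a c w1 in \<open>simp_all add: ac\<close>)
  have "((\<lambda>((A, B), n). dsgn (n - B) (A + (int M + 1) * B) * theta_mono M \<tau> s y x A B n)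
      has_sum theta 0 (m + 1) \<tau> w2 * Phi1 m 0 \<tau> c (s - c) 0) UNIV"
    unfolding a2 unfolding ac by (rule theta_Phi1_expansion[OF m]) (use a c w2 in \<open>simp_all add: ac\<close>)
  also have "?this \<longleftrightarrow> ((\<lambda>((A, B), n). dsgn (n - A) (B + (int M + 1) * A) * theta_mono M \<tau> s x y A B n)
      has_sum theta 0 (m + 1) \<tau> w2 * Phi1 m 0 \<tau> c (s - c) 0) UNIV"
    by (rule has_sum_reindex_bij_witness[of _ "\<lambda>((A, B), n). ((B, A), n)" "\<lambda>((A, B), n). ((B, A), n)"])
      (auto simp: theta_mono_swap[of M \<tau> s x y])
  finally have 2: "((\<lambda>((A, B), n). dsgn (n - A) (B + (int M + 1) * A) * theta_mono M \<tau> s x y A B n)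
      has_sum theta 0 (m + 1) \<tau> w2 * Phi1 m 0 \<tau> c (s - c) 0) UNIV" .
  have 3: "((\<lambda>((A, B), n). dsgn (A - n - 1) (n - B) * theta_mono M \<tau> s x y A B n) has_sum
      \<i> * theta 0 (m + 1) \<tau> w3 * (dedekind_eta \<tau> ^ 3 * vartheta 1 1 \<tau> (a - c) / (vartheta 1 1 \<tau> a * vartheta 1 1 \<tau> c))) UNIV"
    using theta_kronecker_expansion[OF m a c ac w3]
    unfolding kronecker_theta_quotient[OF a strip_not_in_lattice[OF c]] by (simp add: mult_ac)
  define f1 f2 f3 where "f1 = (\<lambda>((A, B), n). dsgn (n - B) (A + (int M + 1) * B) * theta_mono M \<tau> s x y A B n)"
    and "f2 = (\<lambda>((A, B), n). dsgn (n - A) (B + (int M + 1) * A) * theta_mono M \<tau> s x y A B n)"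
    and "f3 = (\<lambda>((A, B), n). dsgn (A - n - 1) (n - B) * theta_mono M \<tau> s x y A B n)"
  have "((\<lambda>p. f1 p + - f2 p + - f3 p) has_sum ?X) UNIV"
    using has_sum_add[OF has_sum_add[OF 1 has_sum_uminusI[OF 2]] has_sum_uminusI[OF 3]]
    unfolding f1_def[symmetric] f2_def[symmetric] f3_def[symmetric] by (simp only: diff_conv_add_uminus)
  moreover have "(case p of ((A, B), n) \<Rightarrow> half_plane_sgn M A B * theta_mono M \<tau> s x y A B n) = f1 p + - f2 p + - f3 p" for p
  proof -
    obtain A B n where p: "p = ((A, B), n)" by (metis surj_pair)
    show ?thesis
      unfolding p f1_def f2_def f3_def case_prod_conv sgn_cancellation[of n B A M, symmetric]
      by (simp only: left_diff_distrib) simp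
  qed
  ultimately have "((\<lambda>p. case p of ((A, B), n) \<Rightarrow> half_plane_sgn M A B * theta_mono M \<tau> s x y A B n) has_sum ?X) (UNIV \<times> UNIV)"
    by simp
  then have "((\<lambda>p. half_plane_sgn M (fst p) (snd p) * lattice_weight M \<tau> x y (fst p) (snd p) * theta (of_int (fst p + snd p)) m \<tau> s) has_sum ?X) UNIV"
  proof (rule has_sum_SigmaD)
    fix p :: "int \<times> int"
    obtain A B where p: "p = (A, B)" by fastforce
    define t where "t n = ee ((2 * of_real m * \<tau>) * of_int n ^ 2 + (2 * of_real (real_of_int (A + B)) * \<tau> + 2 * of_real m * s) * of_int n
            + (of_real (of_int (A + B)) * s + of_real (of_int (A + B) ^ 2 / (2 * m)) * \<tau>))" for n :: int
    have "(t has_sum theta (of_int (A + B)) m \<tau> s) UNIV"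
      unfolding theta_series[OF m(1)] t_def
      by (rule has_sum_infsum, rule abs_summable_summable, rule ee_quadratic_summable) (use m \<tau> in simp)
    from has_sum_cmult_right[OF this, of "half_plane_sgn M A B * lattice_weight M \<tau> x y A B"]
    have "((\<lambda>n. half_plane_sgn M A B * (lattice_weight M \<tau> x y A B * t n)) has_sum
        half_plane_sgn M A B * lattice_weight M \<tau> x y A B * theta (of_int (A + B)) m \<tau> s) UNIV"
      by (simp add: mult.assoc)
    moreover have "lattice_weight M \<tau> x y A B * t n = theta_mono M \<tau> s x y A B n" for n
      unfolding lattice_weight_def t_def theta_mono_def ee_add[symmetric] M m(2)
      by (rule arg_cong[where f = ee]) (use M0 in \<open>simp add: field_simps power2_eq_square\<close>)
    ultimately show "((\<lambda>n. case (p, n) of ((A, B), n) \<Rightarrow> half_plane_sgn M A B * theta_mono M \<tau> s x y A B n) has_sum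
        half_plane_sgn M (fst p) (snd p) * lattice_weight M \<tau> x y (fst p) (snd p) * theta (of_int (fst p + snd p)) m \<tau> s) UNIV"
      by (simp add: p)
  qed
  then show ?thesis by (simp add: case_prod_unfold)
qed

section \<open>The sectors of the coefficient function\<close>

text \<open>The factor of \<open>\<theta>\<^bsub>k,m\<^esub> - \<theta>\<^bsub>-k,m\<^esub>\<close> in the double sum of the theorem, written in the variables
\<open>x = z1 + z3\<close> and \<open>y = 2 z2 - z1 + z3\<close>.\<close>

definition correction_term :: "nat \<Rightarrow> complex \<Rightarrow> complex \<Rightarrow> complex \<Rightarrow> nat \<Rightarrow> nat \<Rightarrow> complex" where
  "correction_term M \<tau> x y j k =
     ee ((of_nat (M + 2) * of_nat j ^ 2 - of_nat k ^ 2 / of_nat M) * \<tau>) *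
      (ee (of_nat j * (x - y)) * ee (- of_int (int M * int j - int k) * y)
     + ee (- of_nat j * (x - y)) * ee (of_int (int M * int j - int k) * y)
     - ee (of_nat j * (x - y)) * ee (of_int (int M * int j - int k) * x)
     - ee (- of_nat j * (x - y)) * ee (- of_int (int M * int j - int k) * x))"

text \<open>The double sector is cut along \<open>A + B = 0\<close>.  On this line and on the boundary of the sector, where
\<open>k = 0\<close>, the index \<open>A + B\<close> is a multiple of \<open>M\<close>, so that \<open>\<Theta>\<close> vanishes by periodicity and
oddness.  In the interior of each of the four pieces the stated parameters exist.\<close>

lemma half_plane_sgn_support:
  fixes \<Theta> :: "int \<Rightarrow> complex"
  assumes M: "M > 0" and per: "\<And>K i. \<Theta> (K + int M * i) = \<Theta> K" and odd: "\<And>K. \<Theta> (- K) = - \<Theta> K"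
    and nz: "half_plane_sgn M A B \<noteq> 0" "\<Theta> (A + B) \<noteq> 0"
  obtains j k where "j \<ge> 1" "k \<in> {1..<M * j}"
    "(A, B) \<in> {(int j, int k - (int M + 1) * int j), (- int j, (int M + 1) * int j - int k),
                ((int M + 1) * int j - int k, - int j), (int k - (int M + 1) * int j, int j)}"
proof -
  note witness = that
  have "\<Theta> 0 = 0" using odd[of 0] by simp
  then have \<Theta>M: "\<Theta> (int M * i) = 0" for i using per[of 0 i] by simp
  have K0: "A + B \<noteq> 0" using nz(2) \<open>\<Theta> 0 = 0\<close> by auto
  have *: thesis if "J > 0" "k > 0" "k < int M * J"
    "(A, B) \<in> {(J, k - (int M + 1) * J), (- J, (int M + 1) * J - k),
                ((int M + 1) * J - k, - J), (k - (int M + 1) * J, J)}" for J k :: int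
  proof (rule witness[of "nat J" "nat k"])
    show "nat J \<ge> 1" using \<open>J > 0\<close> by simp
    have "int (nat k) < int (M * nat J)" using \<open>J > 0\<close> \<open>k > 0\<close> \<open>k < int M * J\<close> by simp
    then have "nat k < M * nat J" by (simp only: of_nat_less_iff)
    then show "nat k \<in> {1..<M * nat J}" using \<open>k > 0\<close> by simp
  qed (use \<open>J > 0\<close> \<open>k > 0\<close> \<open>(A, B) \<in> _\<close> in simp)
  consider (1) "B + (int M + 1) * A \<ge> 0" "A + (int M + 1) * B < 0" "A + B < 0"
    | (2) "B + (int M + 1) * A \<ge> 0" "A + (int M + 1) * B < 0" "A + B > 0"
    | (3) "B + (int M + 1) * A < 0" "A + (int M + 1) * B \<ge> 0" "A + B > 0"
    | (4) "B + (int M + 1) * A < 0" "A + (int M + 1) * B \<ge> 0" "A + B < 0"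
  proof -
    have "(0 \<le> A + (int M + 1) * B) \<noteq> (0 \<le> B + (int M + 1) * A)"
      using nz(1) by (auto simp: half_plane_sgn_def)
    moreover have "A + B < 0 \<or> A + B > 0" using K0 by linarith
    ultimately show thesis using that by (metis not_le)
  qed
  then show ?thesis
  proof cases
    case 1
    then have "int M * A > 0" by (simp add: algebra_simps)
    then have "A > 0" using M by (simp add: zero_less_mult_iff)
    moreover have "B + (int M + 1) * A \<noteq> 0"
    proof
      assume "B + (int M + 1) * A = 0"
      then have "A + B = int M * (- A)" by (simp add: algebra_simps)
      then show False using nz(2) \<Theta>M by metis
    qed
    ultimately show ?thesis using 1 by (intro *[of A "B + (int M + 1) * A"]) (auto simp: algebra_simps)
  next
    case 2
    then have "int M * B < 0" by (simp add: algebra_simps)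
    then have "B < 0" using M by (simp add: mult_less_0_iff)
    then show ?thesis using 2 by (intro *[of "- B" "- (A + (int M + 1) * B)"]) (auto simp: algebra_simps)
  next
    case 3
    then have "int M * A < 0" by (simp add: algebra_simps)
    then have "A < 0" using M by (simp add: mult_less_0_iff)
    then show ?thesis using 3 by (intro *[of "- A" "- (B + (int M + 1) * A)"]) (auto simp: algebra_simps)
  next
    case 4
    then have "int M * B > 0" by (simp add: algebra_simps)
    then have "B > 0" using M by (simp add: zero_less_mult_iff)
    moreover have "A + (int M + 1) * B \<noteq> 0"
    proof
      assume "A + (int M + 1) * B = 0"
      then have "A + B = int M * (- B)" by (simp add: algebra_simps)
      then show False using nz(2) \<Theta>M by metis
    qed
    ultimately show ?thesis using 4 by (intro *[of B "A + (int M + 1) * B"]) (auto simp: algebra_simps)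
  qed
qed

text \<open>The four pieces of the double sector are disjoint copies of the set of pairs with \<open>1 \<le> k < Mj\<close>.  In
all of them \<open>A + B\<close> is congruent to \<open>k\<close> or \<open>-k\<close> modulo \<open>M\<close>, so \<open>\<Theta>(A + B) = \<plusminus>\<Theta>(k)\<close>, and the signs combine
to those of the four exponentials.  Pairs with \<open>k = Mj\<close> may be added because \<open>\<Theta>(Mj) = 0\<close>.\<close>

lemma half_plane_sum_eq_correction:
  fixes \<Theta> :: "int \<Rightarrow> complex"
  assumes M: "M > 0" and per: "\<And>K i. \<Theta> (K + int M * i) = \<Theta> K" and odd: "\<And>K. \<Theta> (- K) = - \<Theta> K"
    and X: "((\<lambda>(A, B). half_plane_sgn M A B * lattice_weight M \<tau> x y A B * \<Theta> (A + B)) has_sum X) UNIV"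
  shows "((\<lambda>j. \<Sum>k = 1..M * j. correction_term M \<tau> x y j k * \<Theta> (int k)) has_sum - X) {1..}"
proof -
  define f where "f = (\<lambda>(A, B). half_plane_sgn M A B * lattice_weight M \<tau> x y A B * \<Theta> (A + B))"
  define I where "I = Sigma {1::nat..} (\<lambda>j. {1..<M * j})"
  define \<phi>1 where "\<phi>1 = (\<lambda>(j, k). (int j, int k - (int M + 1) * int j))"
  define \<phi>2 where "\<phi>2 = (\<lambda>(j, k). (- int j, (int M + 1) * int j - int k))"
  define \<phi>3 where "\<phi>3 = (\<lambda>(j, k). ((int M + 1) * int j - int k, - int j))"
  define \<phi>4 where "\<phi>4 = (\<lambda>(j, k). (int k - (int M + 1) * int j, int j))"
  note \<phi> = \<phi>1_def \<phi>2_def \<phi>3_def \<phi>4_def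
  have inj: "inj_on \<phi>1 I" "inj_on \<phi>2 I" "inj_on \<phi>3 I" "inj_on \<phi>4 I"
    by (auto simp: \<phi> inj_on_def)
  have Isub: "0 < int k" "int k < int M * int j" "0 < int j" if "(j, k) \<in> I" for j k
    using that by (auto simp: I_def simp flip: of_nat_mult)
  have img: "\<phi>1 ` I \<subseteq> {(A, B). 0 < A \<and> A + B < 0}" "\<phi>2 ` I \<subseteq> {(A, B). A < 0 \<and> A + B > 0}"
    "\<phi>3 ` I \<subseteq> {(A, B). 0 < A \<and> A + B > 0}" "\<phi>4 ` I \<subseteq> {(A, B). A < 0 \<and> A + B < 0}"
    by (auto simp: \<phi> algebra_simps dest: Isub)
  have disj: "S \<inter> T = {}" if "S \<subseteq> S'" "T \<subseteq> T'" "S' \<inter> T' = {}" for S S' T T' :: "(int \<times> int) set"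
    using that by blast
  have disjoint: "\<phi>1 ` I \<inter> \<phi>2 ` I = {}" "(\<phi>1 ` I \<union> \<phi>2 ` I) \<inter> \<phi>3 ` I = {}"
    "((\<phi>1 ` I \<union> \<phi>2 ` I) \<union> \<phi>3 ` I) \<inter> \<phi>4 ` I = {}"
    by (rule disj[OF img(1,2)] disj[OF Un_mono[OF img(1,2)] img(3)] disj[OF Un_mono[OF Un_mono[OF img(1,2)] img(3)] img(4)]; force)+
  have f: "(f has_sum X) UNIV" using X by (simp add: f_def)
  then have su: "f summable_on UNIV" by (auto simp: has_sum_iff)
  have su': "f summable_on S" for S
    using su by (rule summable_on_subset_banach) simp
  define U where "U = ((\<phi>1 ` I \<union> \<phi>2 ` I) \<union> \<phi>3 ` I) \<union> \<phi>4 ` I"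
  have "(f has_sum X) U"
  proof -
    have "f p = 0" if "p \<in> UNIV - U" for p
    proof (rule ccontr)
      assume "f p \<noteq> 0"
      moreover obtain A B where p: "p = (A, B)" by fastforce
      ultimately have "half_plane_sgn M A B \<noteq> 0" "\<Theta> (A + B) \<noteq> 0" by (auto simp: f_def)
      then obtain j k where jk: "j \<ge> 1" "k \<in> {1..<M * j}"
        "(A, B) \<in> {(int j, int k - (int M + 1) * int j), (- int j, (int M + 1) * int j - int k),
                ((int M + 1) * int j - int k, - int j), (int k - (int M + 1) * int j, int j)}"
        using half_plane_sgn_support[where \<Theta> = \<Theta>, OF M per odd] by metis
      then have "(j, k) \<in> I" by (simp add: I_def)
      moreover have "p \<in> {\<phi>1 (j, k), \<phi>2 (j, k), \<phi>3 (j, k), \<phi>4 (j, k)}" using jk(3) by (simp add: p \<phi>)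
      ultimately have "p \<in> U" by (auto simp: U_def)
      then show False using that by simp
    qed
    then show ?thesis using f by (subst has_sum_cong_neutral[of UNIV U f f]) auto
  qed
  moreover have "(f has_sum (((infsum f (\<phi>1 ` I) + infsum f (\<phi>2 ` I)) + infsum f (\<phi>3 ` I)) + infsum f (\<phi>4 ` I))) U"
    unfolding U_def by (intro has_sum_Un_disjoint has_sum_infsum su' disjoint)
  ultimately have X_eq: "X = ((infsum f (\<phi>1 ` I) + infsum f (\<phi>2 ` I)) + infsum f (\<phi>3 ` I)) + infsum f (\<phi>4 ` I)"
    by (rule has_sum_unique)
  have re: "((\<lambda>p. f (\<psi> p)) has_sum infsum f (\<psi> ` I)) I" if "inj_on \<psi> I" for \<psi>
    using has_sum_infsum[OF su', of "\<psi> ` I"] has_sum_reindex[OF that, of f] by (simp add: o_def)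
  have "((\<lambda>p. - (f (\<phi>1 p) + f (\<phi>2 p) + f (\<phi>3 p) + f (\<phi>4 p))) has_sum - X) I"
    unfolding X_eq by (intro has_sum_uminusI has_sum_add re inj)
  moreover have "- (f (\<phi>1 p) + f (\<phi>2 p) + f (\<phi>3 p) + f (\<phi>4 p)) = (case p of (j, k) \<Rightarrow> correction_term M \<tau> x y j k * \<Theta> (int k))"
    if "p \<in> I" for p
  proof -
    obtain j k where p: "p = (j, k)" by fastforce
    note jk = Isub[OF that[unfolded p]]
    have M0: "(of_nat M :: complex) \<noteq> 0" using M by simp
    have neg: "int M * (int k - (int M + 1) * int j) < 0"
    proof -
      have "int k - (int M + 1) * int j < 0" using jk by (simp add: algebra_simps)
      then show ?thesis using M by (simp add: mult_pos_neg)
    qed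
    have s: "half_plane_sgn M (int j) (int k - (int M + 1) * int j) = - 1"
      "half_plane_sgn M (- int j) ((int M + 1) * int j - int k) = 1"
      "half_plane_sgn M ((int M + 1) * int j - int k) (- int j) = - 1"
      "half_plane_sgn M (int k - (int M + 1) * int j) (int j) = 1"
      using neg jk by (auto simp: half_plane_sgn_def algebra_simps)
    have t: "\<Theta> (int j + (int k - (int M + 1) * int j)) = \<Theta> (int k)"
      "\<Theta> (- int j + ((int M + 1) * int j - int k)) = - \<Theta> (int k)"
      "\<Theta> ((int M + 1) * int j - int k + - int j) = - \<Theta> (int k)"
      "\<Theta> (int k - (int M + 1) * int j + int j) = \<Theta> (int k)"
      using per[of "int k" "- int j"] per[of "- int k" "int j"] odd[of "int k"] by (simp_all add: algebra_simps)
    define E where "E = ee ((of_nat (M + 2) * of_nat j ^ 2 - of_nat k ^ 2 / of_nat M) * \<tau>)"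
    have w: "lattice_weight M \<tau> x y (int j) (int k - (int M + 1) * int j) = E * (ee (of_nat j * (x - y)) * ee (- of_int (int M * int j - int k) * y))"
      "lattice_weight M \<tau> x y (- int j) ((int M + 1) * int j - int k) = E * (ee (- of_nat j * (x - y)) * ee (of_int (int M * int j - int k) * y))"
      "lattice_weight M \<tau> x y ((int M + 1) * int j - int k) (- int j) = E * (ee (of_nat j * (x - y)) * ee (of_int (int M * int j - int k) * x))"
      "lattice_weight M \<tau> x y (int k - (int M + 1) * int j) (int j) = E * (ee (- of_nat j * (x - y)) * ee (- of_int (int M * int j - int k) * x))"
      unfolding E_def lattice_weight_def ee_add[symmetric]
      by (rule arg_cong[where f = ee]; use M0 in \<open>simp add: field_simps power2_eq_square\<close>)+
    show ?thesis
      unfolding p f_def \<phi> case_prod_conv s t w correction_term_def E_def[symmetric] by (simp add: algebra_simps)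
  qed
  ultimately have "((\<lambda>(j, k). correction_term M \<tau> x y j k * \<Theta> (int k)) has_sum - X) I"
    by (subst (asm) has_sum_cong) auto
  also have "?this \<longleftrightarrow> ((\<lambda>(j, k). correction_term M \<tau> x y j k * \<Theta> (int k)) has_sum - X) (Sigma {1..} (\<lambda>j. {1..M * j}))"
  proof (rule has_sum_cong_neutral)
    fix p assume "p \<in> Sigma {1..} (\<lambda>j. {1..M * j}) - I"
    then obtain j where "p = (j, M * j)" by (cases p) (auto simp: I_def)
    moreover have "\<Theta> (int M * int j) = 0"
      using per[of 0 "int j"] odd[of 0] by simp
    ultimately show "(case p of (j, k) \<Rightarrow> correction_term M \<tau> x y j k * \<Theta> (int k)) = 0" by simp
  qed (auto simp: I_def)
  finally show ?thesis
    by (rule has_sum_SigmaD) (simp add: has_sum_finiteI)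
qed

section \<open>The identity in the strip\<close>

lemma correction_term_P_term:
  assumes M: "m > 0" "2 * m = real M"
  shows "qpow \<tau> ((m + 1) * real j ^ 2) * qpow \<tau> (- (real k ^ 2 / (4 * m))) * P_term m j k z1 z2 z3 =
           correction_term M \<tau> (z1 + z3) (2 * z2 - z1 + z3) j k"
proof -
  have M': "2 * of_real m = (of_nat M :: complex)" using M(2) by (metis of_real_mult of_real_numeral of_real_of_nat_eq)
  have m0: "(of_real m :: complex) \<noteq> 0" using M(1) by simp
  have 1: "qpow \<tau> ((m + 1) * real j ^ 2) * qpow \<tau> (- (real k ^ 2 / (4 * m))) = ee ((of_nat (M + 2) * of_nat j ^ 2 - of_nat k ^ 2 / of_nat M) * \<tau>)"
    unfolding qpow_ee ee_add[symmetric] of_nat_add M'[symmetric] using m0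
    by (intro arg_cong[where f = ee]) (simp add: field_simps)
  have e: "exp (2 * of_real pi * \<i> * of_nat j * z) = ee (2 * of_nat j * z)"
    "exp (- 2 * of_real pi * \<i> * of_nat j * z) = ee (- 2 * of_nat j * z)"
    "exp (of_real pi * \<i> * c * z) = ee (c * z)"
    "exp (- of_real pi * \<i> * c * z) = ee (- c * z)" for z c
    unfolding ee_def by (simp_all add: mult_ac)
  have k: "of_real (2 * m * real j - real k) = (of_int (int M * int j - int k) :: complex)"
    using M(2) by simp
  have x: "2 * of_nat j * (z1 - z2) = of_nat j * ((z1 + z3) - (2 * z2 - z1 + z3))"
    "- 2 * of_nat j * (z1 - z2) = - of_nat j * ((z1 + z3) - (2 * z2 - z1 + z3))"
    "c * (z1 - 2 * z2 - z3) = - c * (2 * z2 - z1 + z3)" "- c * (z1 - 2 * z2 - z3) = c * (2 * z2 - z1 + z3)" for c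
    by (simp_all add: algebra_simps)
  show ?thesis
    unfolding 1 P_term_def e k unfolding x correction_term_def minus_minus ..
qed

lemma nat_floor_twice:
  assumes "2 * m = real M"
  shows "nat \<lfloor>2 * m * real j\<rfloor> = M * j"
  unfolding assms by (simp flip: of_nat_mult)

text \<open>The half identity at \<open>s\<close> minus the half identity at \<open>-s\<close>.  Each \<open>\<Phi>\<^sub>2\<close> is a \<open>\<Phi>\<^sub>1\<close> with \<open>s\<close> replaced by
\<open>-s\<close>, and the coefficients depend on \<open>s\<close> only through \<open>\<theta>\<^bsub>A+B,m\<^esub>(\<tau>, s)\<close>.\<close>

lemma strip_identity:
  assumes m: "m > 0" "2 * m = real M"
    and z1: "0 < Im z1" "Im z1 < Im \<tau>" and z2: "0 < Im z2" "Im z2 < Im \<tau>"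
    and z3: "0 < Im z3" "Im z3 < Im \<tau>" and z4: "0 < - Im (z1 - z2 - z3)" "- Im (z1 - z2 - z3) < Im \<tau>"
  shows
    "theta 0 (m + 1) \<tau> (((z1 - z2) + of_real m * (z1 + z3)) / of_real (m + 1))
       * Phi m 0 \<tau> z1 (- z3) 0
   - theta 0 (m + 1) \<tau> (((z1 - z2) + of_real m * (z1 - 2 * z2 - z3)) / of_real (m + 1))
       * Phi m 0 \<tau> z2 (z1 - z2 - z3) 0
   + (\<Sum>\<^sub>\<infinity>j\<in>{1::nat..}. \<Sum>k = 1..nat \<lfloor>2 * m * real j\<rfloor>.
        qpow \<tau> ((m + 1) * real j ^ 2) * qpow \<tau> (- (real k ^ 2 / (4 * m)))
        * P_term m j k z1 z2 z3
        * (theta (real k) m \<tau> (z1 - z3) - theta (- real k) m \<tau> (z1 - z3)))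
   = \<i> * theta 0 (m + 1) \<tau> (((z1 + z2) + of_real m * (z1 - z3)) / of_real (m + 1))
       * (dedekind_eta \<tau> ^ 3 * vartheta 1 1 \<tau> (z1 - z2)
          / (vartheta 1 1 \<tau> z1 * vartheta 1 1 \<tau> z2))
   + \<i> * theta 0 (m + 1) \<tau> (((z1 - z2 - 2 * z3) + of_real m * (z1 - z3)) / of_real (m + 1))
       * (dedekind_eta \<tau> ^ 3 * vartheta 1 1 \<tau> (z1 - z2)
          / (vartheta 1 1 \<tau> z3 * vartheta 1 1 \<tau> (z1 - z2 - z3)))"
proof -
  define s x y where "s = z1 - z3" and "x = z1 + z3" and "y = 2 * z2 - z1 + z3"
  define w1 w2 w3 w4 where "w1 = ((z1 - z2) + of_real m * (z1 + z3)) / of_real (m + 1)"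
    and "w2 = ((z1 - z2) + of_real m * (z1 - 2 * z2 - z3)) / of_real (m + 1)"
    and "w3 = ((z1 + z2) + of_real m * (z1 - z3)) / of_real (m + 1)"
    and "w4 = ((z1 - z2 - 2 * z3) + of_real m * (z1 - z3)) / of_real (m + 1)"
  have M: "of_nat M = (2 * of_real m :: complex)" using m(2) by (metis of_real_mult of_real_numeral of_real_of_nat_eq)
  have M0: "M > 0" using m by (metis mult_pos_pos of_nat_0_less_iff zero_less_numeral)
  have "(of_real (m + 1) :: complex) \<noteq> 0" using m(1) by (simp del: of_real_add)
  then have w: "of_real (m + 1) * (z / of_real (m + 1)) = z" for z :: complex by simp
  have w': "2 * of_real (m + 1) * w1 = of_nat (M + 1) * x - y"
    "2 * of_real (m + 1) * (- w2) = of_nat (M + 1) * y - x"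
    "2 * of_real (m + 1) * w3 = of_nat (M + 2) * s + x + y"
    "2 * of_real (m + 1) * (- w4) = of_nat (M + 2) * (- s) + x + y"
    unfolding mult_minus_right mult.assoc w1_def w2_def w3_def w4_def w
    by (simp_all add: M s_def x_def y_def algebra_simps)
  have even: "theta 0 m' \<tau> (- z) = theta 0 m' \<tau> z" for m' z
    using theta_uminus[of 0 m' \<tau> z] by simp
  define \<Theta> where "\<Theta> K = theta (of_int K) m \<tau> s - theta (of_int (- K)) m \<tau> s" for K :: int
  define X where "X s a c w = theta 0 (m + 1) \<tau> w1 * Phi1 m 0 \<tau> a (s - a) 0 - theta 0 (m + 1) \<tau> (- w2) * Phi1 m 0 \<tau> c (s - c) 0
      - \<i> * theta 0 (m + 1) \<tau> w * (dedekind_eta \<tau> ^ 3 * vartheta 1 1 \<tau> (a - c) / (vartheta 1 1 \<tau> a * vartheta 1 1 \<tau> c))" for s a c w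
  define g where "g s = (\<lambda>(A, B). half_plane_sgn M A B * lattice_weight M \<tau> x y A B * theta (of_int (A + B)) m \<tau> s)" for s
  have plus: "(g s has_sum X s z1 z2 w3) UNIV"
    unfolding g_def X_def by (rule strip_half_identity[OF m z1 z2]) (use w' in \<open>auto simp: s_def x_def y_def\<close>)
  have minus: "(g (- s) has_sum X (- s) z3 (- (z1 - z2 - z3)) (- w4)) UNIV"
    unfolding g_def X_def by (rule strip_half_identity[OF m z3]) (use z4 w' in \<open>auto simp: s_def x_def y_def\<close>)
  define V where "V = X s z1 z2 w3 - X (- s) z3 (- (z1 - z2 - z3)) (- w4)"
  have "((\<lambda>p. g s p + - g (- s) p) has_sum V) UNIV"
    using has_sum_add[OF plus has_sum_uminusI[OF minus]] by (simp add: V_def)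
  also have "(\<lambda>p. g s p + - g (- s) p) = (\<lambda>(A, B). half_plane_sgn M A B * lattice_weight M \<tau> x y A B * \<Theta> (A + B))"
    by (auto simp: fun_eq_iff g_def \<Theta>_def theta_uminus algebra_simps)
  finally have V: "((\<lambda>(A, B). half_plane_sgn M A B * lattice_weight M \<tau> x y A B * \<Theta> (A + B)) has_sum V) UNIV" .
  have "((\<lambda>j. \<Sum>k = 1..M * j. correction_term M \<tau> x y j k * \<Theta> (int k)) has_sum - V) {1..}"
  proof (rule half_plane_sum_eq_correction[OF M0 _ _ V])
    fix K i :: int
    have "theta (of_int (K + int M * i)) m \<tau> s = theta (of_int K) m \<tau> s" for K i
      using theta_shift[OF m(1), of "of_int K" i \<tau> s] by (simp add: m(2))
    from this[of K i] this[of "- K" "- i"]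
    show "\<Theta> (K + int M * i) = \<Theta> K" by (simp add: \<Theta>_def)
  qed (simp add: \<Theta>_def)
  then have corr: "(\<Sum>\<^sub>\<infinity>j\<in>{1::nat..}. \<Sum>k = 1..nat \<lfloor>2 * m * real j\<rfloor>.
        qpow \<tau> ((m + 1) * real j ^ 2) * qpow \<tau> (- (real k ^ 2 / (4 * m)))
        * P_term m j k z1 z2 z3
        * (theta (real k) m \<tau> (z1 - z3) - theta (- real k) m \<tau> (z1 - z3))) = - V"
    unfolding correction_term_P_term[OF m] nat_floor_twice[OF m(2)]
    by (simp add: has_sum_iff x_def y_def \<Theta>_def s_def)
  have arg: "s - z1 = - z3" "s - z2 = z1 - z2 - z3" "- s - z3 = - z1" "- s - - (z1 - z2 - z3) = - z2"
    "z3 - - (z1 - z2 - z3) = z1 - z2" "- (- z3) = z3"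
    by (simp_all add: s_def)
  show ?thesis
    unfolding corr w1_def[symmetric] w2_def[symmetric] w3_def[symmetric] w4_def[symmetric]
    unfolding V_def X_def arg even vartheta11_odd Phi_def Phi2_eq_Phi1
    by (simp add: algebra_simps)
qed

section \<open>Analytic continuation\<close>

lemma holomorphic_theta [holomorphic_intros]:
  assumes "open U" "f holomorphic_on U" "Im \<tau> > 0" "m > 0"
  shows "(\<lambda>t. theta k m \<tau> (f t)) holomorphic_on U"
  unfolding theta_series[OF assms(4)]
  by (rule holomorphic_gauss_series) (use assms in \<open>auto intro!: holomorphic_intros\<close>)

lemma holomorphic_Phi:
  assumes "open U" "f holomorphic_on U" "g holomorphic_on U" "Im \<tau> > 0" "m > 0"
    and "\<And>t. t \<in> U \<Longrightarrow> f t \<notin> period_lattice \<tau>" "\<And>t. t \<in> U \<Longrightarrow> g t \<notin> period_lattice \<tau>"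
  shows "(\<lambda>t. Phi m 0 \<tau> (f t) (g t) 0) holomorphic_on U"
proof -
  have "(\<lambda>t. Phi1 m 0 \<tau> (f t) (g t) 0) holomorphic_on U"
    if "f holomorphic_on U" "g holomorphic_on U" "\<And>t. t \<in> U \<Longrightarrow> f t \<notin> period_lattice \<tau>" for f g
    unfolding Phi1_series by (rule holomorphic_lerch_series) (use assms that in \<open>auto intro!: holomorphic_intros\<close>)
  from this[of f g] this[of "\<lambda>t. - g t" "\<lambda>t. - f t"] show ?thesis
    unfolding Phi_def Phi2_eq_Phi1 by (intro holomorphic_on_diff) (use assms in \<open>auto simp: period_lattice_uminus intro!: holomorphic_intros\<close>)
qed

text \<open>As \<open>k \<le> Mj\<close>, the exponent \<open>(M+2) j\<^sup>2 - k\<^sup>2/M\<close> is at least \<open>2 j\<^sup>2\<close>, which beats the exponential growth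
in \<open>j\<close>.\<close>

lemma norm_correction_term_le:
  assumes M: "M > 0" and \<tau>: "Im \<tau> > 0" and k: "k \<le> M * j" and D: "\<bar>Im x\<bar> + \<bar>Im y\<bar> \<le> D"
  shows "norm (correction_term M \<tau> x y j k) \<le> 4 * exp (- (2 * pi * Im \<tau>) * real j ^ 2 + pi * (M + 1) * D * real j)"
proof -
  have exp_le: "norm (ee (u * (x - y)) * ee (v * z)) \<le> exp (pi * (M + 1) * D * real j)"
    if "u = of_nat j \<or> u = - of_nat j" "v = of_int (int M * int j - int k) \<or> v = - of_int (int M * int j - int k)" "z = x \<or> z = y" for u v z
  proof -
    have v: "\<bar>real_of_int (int M * int j - int k)\<bar> \<le> real M * real j"
    proof -
      have "real k \<le> real M * real j" using k by (simp flip: of_nat_mult)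
      then show ?thesis by simp
    qed
    have "norm (ee (u * (x - y)) * ee (v * z)) = exp (- pi * (Im (u * (x - y)) + Im (v * z)))"
      by (simp add: norm_mult norm_ee ring_distribs flip: exp_add)
    also have "\<dots> = exp (- pi * (Re u * Im (x - y) + Re v * Im z))" using that by auto
    also have "exp (- pi * (Re u * Im (x - y) + Re v * Im z)) \<le> exp (pi * ((M + 1) * D * real j))"
    proof -
      have "\<bar>Re u * Im (x - y) + Re v * Im z\<bar> \<le> \<bar>Re u\<bar> * \<bar>Im (x - y)\<bar> + \<bar>Re v\<bar> * \<bar>Im z\<bar>"
        unfolding abs_mult[symmetric] by (rule abs_triangle_ineq)
      also have "\<dots> \<le> real j * D + real M * real j * D"
        using that v D by (intro add_mono mult_mono) auto
      also have "\<dots> = (M + 1) * D * real j" by (simp add: algebra_simps)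
      finally have "- (Re u * Im (x - y) + Re v * Im z) \<le> (M + 1) * D * real j" by linarith
      then have "pi * (- (Re u * Im (x - y) + Re v * Im z)) \<le> pi * ((M + 1) * D * real j)" by (rule mult_left_mono) simp
      then show ?thesis by (simp only: exp_le_cancel_iff mult_minus_left mult_minus_right)
    qed
    finally show ?thesis by (simp add: mult.assoc)
  qed
  have gauss: "norm (ee ((of_nat (M + 2) * of_nat j ^ 2 - of_nat k ^ 2 / of_nat M) * \<tau>)) \<le> exp (- (2 * pi * Im \<tau>) * real j ^ 2)"
  proof -
    have "real k ^ 2 \<le> (real M * real j) ^ 2"
      using k by (intro power_mono) (simp_all flip: of_nat_mult)
    then have "real k ^ 2 / real M \<le> real M * real j ^ 2"
      using M by (simp add: field_simps power2_eq_square)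
    then have "2 * real j ^ 2 \<le> real (M + 2) * real j ^ 2 - real k ^ 2 / real M"
      by (simp add: algebra_simps)
    then have "2 * real j ^ 2 * (pi * Im \<tau>) \<le> (real (M + 2) * real j ^ 2 - real k ^ 2 / real M) * (pi * Im \<tau>)"
      using \<tau> by (intro mult_right_mono) auto
    moreover have "Im ((of_nat (M + 2) * of_nat j ^ 2 - of_nat k ^ 2 / of_nat M) * \<tau>) = (real (M + 2) * real j ^ 2 - real k ^ 2 / real M) * Im \<tau>"
    proof -
      have "(of_nat (M + 2) * of_nat j ^ 2 - of_nat k ^ 2 / of_nat M :: complex) = of_real (real (M + 2) * real j ^ 2 - real k ^ 2 / real M)"
        by simp
      then show ?thesis by (metis Im_complex_of_real Re_complex_of_real add.right_neutral mult_zero_left times_complex.sel(2))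
    qed
    ultimately show ?thesis unfolding norm_ee by (simp add: mult_ac)
  qed
  have "norm (correction_term M \<tau> x y j k) \<le> exp (- (2 * pi * Im \<tau>) * real j ^ 2) *
      (exp (pi * (M + 1) * D * real j) + exp (pi * (M + 1) * D * real j) + exp (pi * (M + 1) * D * real j) + exp (pi * (M + 1) * D * real j))"
    unfolding correction_term_def norm_mult[of "ee ((of_nat (M + 2) * of_nat j ^ 2 - of_nat k ^ 2 / of_nat M) * \<tau>)"]
    by (intro mult_mono gauss norm_triangle_le_diff norm_triangle_le add_mono exp_le order_trans[OF norm_triangle_ineq4] order_trans[OF norm_triangle_ineq]) auto
  also have "\<dots> = 4 * exp (- (2 * pi * Im \<tau>) * real j ^ 2 + pi * (M + 1) * D * real j)"
    unfolding exp_add by (simp only: mult_2[symmetric]) simp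
  finally show ?thesis .
qed

text \<open>The bound is uniform in \<open>k\<close> because the theta function depends on \<open>k\<close> only modulo \<open>M\<close>.\<close>

lemma theta_bounded_compact:
  assumes m: "m > 0" "2 * m = real M" and \<tau>: "Im \<tau> > 0" and U: "open U" and s: "s holomorphic_on U"
    and K: "compact K" "K \<subseteq> U"
  obtains C where "C \<ge> 0" "\<And>k t. t \<in> K \<Longrightarrow> norm (theta (of_int k) m \<tau> (s t)) \<le> C"
proof -
  have M0: "M > 0" using m by (metis mult_pos_pos of_nat_0_less_iff zero_less_numeral)
  have "\<exists>b\<ge>0. \<forall>t\<in>K. norm (theta (of_int r) m \<tau> (s t)) \<le> b" for r :: int
  proof -
    have "continuous_on K (\<lambda>t. theta (of_int r) m \<tau> (s t))"
      by (rule continuous_on_subset[OF holomorphic_on_imp_continuous_on[OF holomorphic_theta[OF U s \<tau> m(1)]] K(2)])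
    then have "compact ((\<lambda>t. theta (of_int r) m \<tau> (s t)) ` K)" using K(1) by (rule compact_continuous_image)
    then obtain b where "b > 0" "\<forall>w\<in>(\<lambda>t. theta (of_int r) m \<tau> (s t)) ` K. norm w \<le> b"
      using compact_imp_bounded bounded_pos by blast
    then show ?thesis by (intro exI[of _ b]) auto
  qed
  then obtain b where b: "\<And>r. b r \<ge> 0" "\<And>r t. t \<in> K \<Longrightarrow> norm (theta (of_int r) m \<tau> (s t)) \<le> b r" by metis
  have "norm (theta (of_int k) m \<tau> (s t)) \<le> (\<Sum>r\<in>{0..<int M}. b r)" if "t \<in> K" for k t
  proof -
    define r where "r = k mod int M"
    have "real_of_int k = of_int r + 2 * m * of_int (k div int M)"
      unfolding m(2) r_def by (metis add.commute mult.commute mult_div_mod_eq of_int_add of_int_mult of_int_of_nat_eq)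
    then have "norm (theta (of_int k) m \<tau> (s t)) \<le> b r"
      using b(2)[OF that, of r] by (simp add: theta_shift[OF m(1)])
    also have "\<dots> \<le> (\<Sum>r\<in>{0..<int M}. b r)"
      using M0 b(1) by (intro member_le_sum) (auto simp: r_def)
    finally show ?thesis .
  qed
  moreover have "(\<Sum>r\<in>{0..<int M}. b r) \<ge> 0" using b(1) by (intro sum_nonneg)
  ultimately show ?thesis using that by blast
qed

lemma holomorphic_correction_sum:
  assumes m: "m > 0" "2 * m = real M" and \<tau>: "Im \<tau> > 0" and U: "open U"
    and hol: "s holomorphic_on U" "x holomorphic_on U" "y holomorphic_on U"
  shows "(\<lambda>t. \<Sum>\<^sub>\<infinity>j\<in>{1::nat..}. \<Sum>k = 1..M * j. correction_term M \<tau> (x t) (y t) j k *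
            (theta (real k) m \<tau> (s t) - theta (- real k) m \<tau> (s t))) holomorphic_on U"
proof (rule holomorphic_on_infsum)
  show "open U" by fact
  show "(\<lambda>t. \<Sum>k = 1..M * j. correction_term M \<tau> (x t) (y t) j k *
            (theta (real k) m \<tau> (s t) - theta (- real k) m \<tau> (s t))) holomorphic_on U" for j
    unfolding correction_term_def using m \<tau> U by (intro holomorphic_intros hol)
  fix K assume K: "compact K" "K \<subseteq> U"
  have M0: "M > 0" using m by (metis mult_pos_pos of_nat_0_less_iff zero_less_numeral)
  obtain C where C: "C \<ge> 0" "\<And>k t. t \<in> K \<Longrightarrow> norm (theta (of_int k) m \<tau> (s t)) \<le> C"
    using theta_bounded_compact[OF m \<tau> U hol(1) K] by blast
  note bdd = holomorphic_Im_bounded_on_compact[OF _ K]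
  obtain bx by' where "\<forall>t\<in>K. \<bar>Im (x t)\<bar> \<le> bx" "\<forall>t\<in>K. \<bar>Im (y t)\<bar> \<le> by'"
    using bdd hol by meson
  then obtain D where D: "\<And>t. t \<in> K \<Longrightarrow> \<bar>Im (x t)\<bar> + \<bar>Im (y t)\<bar> \<le> D"
    by (meson add_mono)
  define E where "E j = exp (- (2 * pi * Im \<tau>) * real j ^ 2 + pi * (M + 1) * D * real j)" for j
  \<comment> \<open>the number \<open>Mj\<close> of inner terms is absorbed by raising the linear exponent by \<open>1\<close>\<close>
  define B where "B j = 8 * C * M * exp (- (2 * pi * Im \<tau>) * real j ^ 2 + (pi * (M + 1) * D + 1) * real j)" for j
  have "norm (\<Sum>k = 1..M * j. correction_term M \<tau> (x t) (y t) j k * (theta (real k) m \<tau> (s t) - theta (- real k) m \<tau> (s t))) \<le> B j"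
    if t: "t \<in> K" for t j
  proof -
    have "norm (\<Sum>k = 1..M * j. correction_term M \<tau> (x t) (y t) j k * (theta (real k) m \<tau> (s t) - theta (- real k) m \<tau> (s t)))
        \<le> (\<Sum>k = 1..M * j. 4 * E j * (2 * C))"
    proof (rule sum_norm_le)
      fix k assume k: "k \<in> {1..M * j}"
      have "norm (theta (real k) m \<tau> (s t) - theta (- real k) m \<tau> (s t)) \<le> norm (theta (real k) m \<tau> (s t)) + norm (theta (- real k) m \<tau> (s t))"
        by (rule norm_triangle_ineq4)
      also have "\<dots> \<le> 2 * C" using C(2)[OF t, of "int k"] C(2)[OF t, of "- int k"] by simp
      finally show "norm (correction_term M \<tau> (x t) (y t) j k * (theta (real k) m \<tau> (s t) - theta (- real k) m \<tau> (s t))) \<le> 4 * E j * (2 * C)"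
        unfolding norm_mult E_def using k by (intro mult_mono norm_correction_term_le M0 \<tau> D t) auto
    qed
    also have "\<dots> = 8 * C * M * E j * real j" by simp
    also have "\<dots> \<le> 8 * C * M * E j * exp (real j)"
    proof (rule mult_left_mono)
      show "real j \<le> exp (real j)" using exp_ge_add_one_self[of "real j"] by linarith
    qed (use C(1) in \<open>simp add: E_def\<close>)
    also have "8 * C * M * E j * exp (real j) = B j"
    proof -
      have "E j * exp (real j) = exp (- (2 * pi * Im \<tau>) * real j ^ 2 + (pi * (M + 1) * D + 1) * real j)"
        unfolding E_def exp_add[symmetric] by (rule arg_cong[where f = exp]) (simp add: algebra_simps)
      then show ?thesis by (simp add: B_def)
    qed
    finally show ?thesis .
  qed
  moreover have "B summable_on {1..}"
  proof -
    have "(\<lambda>n::int. exp (- (2 * pi * Im \<tau>) * of_int n ^ 2 + (pi * (M + 1) * D + 1) * \<bar>of_int n\<bar>)) summable_on (int ` {1..})"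
      by (rule summable_on_subset_banach[OF gaussian_summable]) (use \<tau> in auto)
    then have "(\<lambda>j::nat. exp (- (2 * pi * Im \<tau>) * real j ^ 2 + (pi * (M + 1) * D + 1) * real j)) summable_on {1..}"
      by (subst (asm) summable_on_reindex) (auto simp: o_def)
    then show ?thesis unfolding B_def by (rule summable_on_cmult_right)
  qed
  ultimately show "\<exists>B. B summable_on {1::nat..} \<and> (\<forall>j\<in>{1..}. \<forall>t\<in>K. norm (\<Sum>k = 1..M * j. correction_term M \<tau> (x t) (y t) j k *
      (theta (real k) m \<tau> (s t) - theta (- real k) m \<tau> (s t))) \<le> B j)"
    by blast
qed

lemma countable_line_lattice:
  assumes "z \<notin> period_lattice \<tau>"
  shows "countable {t. z + t * (w - z) \<in> period_lattice \<tau>}"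
proof (cases "w = z")
  case False
  have "{t. z + t * (w - z) \<in> period_lattice \<tau>} \<subseteq> (\<lambda>l. (l - z) / (w - z)) ` period_lattice \<tau>"
  proof
    fix t assume "t \<in> {t. z + t * (w - z) \<in> period_lattice \<tau>}"
    then show "t \<in> (\<lambda>l. (l - z) / (w - z)) ` period_lattice \<tau>"
      using False by (intro image_eqI[of _ _ "z + t * (w - z)"]) auto
  qed
  then show ?thesis by (rule countable_subset) (simp add: countable_period_lattice)
qed (use assms in simp)

theorem proposition3p1:
  fixes m :: real and \<tau> z1 z2 z3 :: complex
  assumes "m > 0" and "2 * m \<in> \<nat>"
    and "Im \<tau> > 0"
    and "z1 \<notin> period_lattice \<tau>"
    and "z2 \<notin> period_lattice \<tau>"
    and "z3 \<notin> period_lattice \<tau>"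
    and "z1 - z2 - z3 \<notin> period_lattice \<tau>"
  shows
    "theta 0 (m + 1) \<tau> (((z1 - z2) + of_real m * (z1 + z3)) / of_real (m + 1))
       * Phi m 0 \<tau> z1 (- z3) 0
   - theta 0 (m + 1) \<tau> (((z1 - z2) + of_real m * (z1 - 2 * z2 - z3)) / of_real (m + 1))
       * Phi m 0 \<tau> z2 (z1 - z2 - z3) 0
   + (\<Sum>\<^sub>\<infinity>j\<in>{1::nat..}. \<Sum>k = 1..nat \<lfloor>2 * m * real j\<rfloor>.
        qpow \<tau> ((m + 1) * real j ^ 2) * qpow \<tau> (- (real k ^ 2 / (4 * m)))
        * P_term m j k z1 z2 z3
        * (theta (real k) m \<tau> (z1 - z3) - theta (- real k) m \<tau> (z1 - z3)))
   = \<i> * theta 0 (m + 1) \<tau> (((z1 + z2) + of_real m * (z1 - z3)) / of_real (m + 1))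
       * (dedekind_eta \<tau> ^ 3 * vartheta 1 1 \<tau> (z1 - z2)
          / (vartheta 1 1 \<tau> z1 * vartheta 1 1 \<tau> z2))
   + \<i> * theta 0 (m + 1) \<tau> (((z1 - z2 - 2 * z3) + of_real m * (z1 - z3)) / of_real (m + 1))
       * (dedekind_eta \<tau> ^ 3 * vartheta 1 1 \<tau> (z1 - z2)
          / (vartheta 1 1 \<tau> z3 * vartheta 1 1 \<tau> (z1 - z2 - z3)))"
    (is "?L z1 z2 z3 = ?R z1 z2 z3")
proof -
  note \<tau> = \<open>Im \<tau> > 0\<close>
  obtain M where m: "m > 0" "2 * m = real M"
    using assms(1,2) by (auto elim: Nats_cases)
  \<comment> \<open>the line that passes through the given point at \<open>t = 0\<close> and through \<open>(\<tau>/2, \<tau>/2, \<tau>/2)\<close> at \<open>t = 1\<close>\<close>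
  define Z1 Z2 Z3 where "Z1 t = z1 + t * (\<tau> / 2 - z1)" and "Z2 t = z2 + t * (\<tau> / 2 - z2)"
    and "Z3 t = z3 + t * (\<tau> / 2 - z3)" for t
  define d where "d t = (z1 - z2 - z3) + t * (- (\<tau> / 2) - (z1 - z2 - z3))" for t
  have d: "Z1 t - Z2 t - Z3 t = d t" for t
    by (simp add: Z1_def Z2_def Z3_def d_def algebra_simps)
  define N where "N = {t. Z1 t \<in> period_lattice \<tau>} \<union> {t. Z2 t \<in> period_lattice \<tau>}
      \<union> {t. Z3 t \<in> period_lattice \<tau>} \<union> {t. d t \<in> period_lattice \<tau>}"
  \<comment> \<open>each of the four affine functions avoids the lattice at \<open>t = 0\<close>; it is therefore injective or avoids the lattice everywhere\<close>
  have "countable N"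
    unfolding N_def Z1_def Z2_def Z3_def d_def using assms by (intro countable_Un countable_line_lattice) auto
  then have conn: "connected (- N)"
    using connected_open_diff_countable[of "UNIV :: complex set" N] connected_UNIV[where 'a = complex]
    by (simp add: Compl_eq_Diff_UNIV)
  have cl: "closed {t. f t \<in> period_lattice \<tau>}" if "continuous_on UNIV f" for f :: "complex \<Rightarrow> complex"
    using closed_vimage[OF closed_period_lattice[OF \<tau>] that] by (simp add: vimage_def)
  have "closed N"
    unfolding N_def Z1_def Z2_def Z3_def d_def by (intro closed_Un cl continuous_intros)
  then have op: "open (- N)" by (simp add: open_Compl)
  define S where "S = {t. 0 < Im (Z1 t) \<and> Im (Z1 t) < Im \<tau> \<and> 0 < Im (Z2 t) \<and> Im (Z2 t) < Im \<tau> \<and>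
      0 < Im (Z3 t) \<and> Im (Z3 t) < Im \<tau> \<and> 0 < - Im (d t) \<and> - Im (d t) < Im \<tau>}"
  have hol: "Z1 holomorphic_on - N" "Z2 holomorphic_on - N" "Z3 holomorphic_on - N" "d holomorphic_on - N"
    unfolding Z1_def[abs_def] Z2_def[abs_def] Z3_def[abs_def] d_def[abs_def] by (intro holomorphic_intros)+
  have notL: "Z1 t \<notin> period_lattice \<tau>" "Z2 t \<notin> period_lattice \<tau>" "Z3 t \<notin> period_lattice \<tau>" "d t \<notin> period_lattice \<tau>"
    if "t \<in> - N" for t using that by (auto simp: N_def)
  have nz: "vartheta 1 1 \<tau> (Z1 t) \<noteq> 0" "vartheta 1 1 \<tau> (Z2 t) \<noteq> 0" "vartheta 1 1 \<tau> (Z3 t) \<noteq> 0" "vartheta 1 1 \<tau> (d t) \<noteq> 0"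
    if "t \<in> - N" for t by (rule vartheta11_nonzero[OF \<tau>], rule notL[OF that])+
  have m1: "of_real (m + 1) \<noteq> (0 :: complex)" using m by (simp del: of_real_add)
  have th: "(\<lambda>t. theta 0 (m + 1) \<tau> (f t / of_real (m + 1))) holomorphic_on - N" if "f holomorphic_on - N" for f
    by (rule holomorphic_theta[OF op _ \<tau>]) (use m m1 that in \<open>auto intro!: holomorphic_on_divide\<close>)
  have vt: "(\<lambda>t. vartheta 1 1 \<tau> (f t)) holomorphic_on - N" if "f holomorphic_on - N" for f
    by (rule holomorphic_vartheta11[OF op that \<tau>])
  have lin: "(\<lambda>t. Z1 t - Z2 t + of_real m * (Z1 t + Z3 t)) holomorphic_on - N"
    "(\<lambda>t. Z1 t - Z2 t + of_real m * (Z1 t - 2 * Z2 t - Z3 t)) holomorphic_on - N"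
    "(\<lambda>t. Z1 t + Z2 t + of_real m * (Z1 t - Z3 t)) holomorphic_on - N"
    "(\<lambda>t. Z1 t - Z2 t - 2 * Z3 t + of_real m * (Z1 t - Z3 t)) holomorphic_on - N"
    "(\<lambda>t. Z1 t - Z2 t) holomorphic_on - N"
    by (intro holomorphic_intros hol)+
  have Phis: "(\<lambda>t. Phi m 0 \<tau> (Z1 t) (- Z3 t) 0) holomorphic_on - N" "(\<lambda>t. Phi m 0 \<tau> (Z2 t) (d t) 0) holomorphic_on - N"
    by (rule holomorphic_Phi[OF op _ _ \<tau> m(1)]; simp add: hol notL period_lattice_uminus holomorphic_on_minus)+
  have corr: "(\<lambda>t. \<Sum>\<^sub>\<infinity>j\<in>{1::nat..}. \<Sum>k = 1..M * j. correction_term M \<tau> (Z1 t + Z3 t) (2 * Z2 t - Z1 t + Z3 t) j k *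
            (theta (real k) m \<tau> (Z1 t - Z3 t) - theta (- real k) m \<tau> (Z1 t - Z3 t))) holomorphic_on - N"
    by (rule holomorphic_correction_sum[OF m \<tau> op]) (intro holomorphic_intros hol)+
  have "?L (Z1 0) (Z2 0) (Z3 0) = ?R (Z1 0) (Z2 0) (Z3 0)"
  proof (rule analytic_continuation_open[where f = "\<lambda>t. ?L (Z1 t) (Z2 t) (Z3 t)" and g = "\<lambda>t. ?R (Z1 t) (Z2 t) (Z3 t)"
        and s = S and s' = "- N"])
    show "open S"
      unfolding S_def Z1_def Z2_def Z3_def d_def by (intro open_Collect_conj open_Collect_less continuous_intros)
    have "1 \<in> S" using \<tau> by (simp add: S_def Z1_def Z2_def Z3_def d_def)
    then show "S \<noteq> {}" by blast
    show "S \<subseteq> - N"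
    proof
      fix t assume "t \<in> S"
      then have "Z1 t \<notin> period_lattice \<tau>" "Z2 t \<notin> period_lattice \<tau>" "Z3 t \<notin> period_lattice \<tau>" "- d t \<notin> period_lattice \<tau>"
        unfolding S_def by (intro strip_not_in_lattice; simp)+
      then show "t \<in> - N" by (simp add: N_def period_lattice_uminus)
    qed
    show "(\<lambda>t. ?L (Z1 t) (Z2 t) (Z3 t)) holomorphic_on - N"
      unfolding correction_term_P_term[OF m] nat_floor_twice[OF m(2)] d
      by (intro holomorphic_on_add holomorphic_on_diff holomorphic_on_mult th Phis corr lin)
    show "(\<lambda>t. ?R (Z1 t) (Z2 t) (Z3 t)) holomorphic_on - N"
      unfolding d
      by (intro holomorphic_on_add holomorphic_on_mult holomorphic_on_divide holomorphic_on_const th vt lin hol;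
          simp only: mult_eq_0_iff nz Compl_iff simp_thms not_False_eq_True)
    show "?L (Z1 t) (Z2 t) (Z3 t) = ?R (Z1 t) (Z2 t) (Z3 t)" if "t \<in> S" for t
      by (rule strip_identity[OF m]) (use that in \<open>auto simp: S_def d\<close>)
    show "0 \<in> - N" using assms by (simp add: N_def Z1_def Z2_def Z3_def d_def)
  qed (rule op conn)+
  then show ?thesis by (simp add: Z1_def Z2_def Z3_def)
qed

end
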